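(* Let $\varphi$ be a linear-fractional selfmap of the open unit disk $\mathbb{D}$ of parabolic type that is not an automorphism of $\mathbb{D}$, and suppose that $\varphi$ vanishes at some point of $\mathbb{D}$. Then the composition operator $C_\varphi:H^2\to H^2$ is both posinormal and coposinormal; however, for every sufficiently large positive integer $n$, the power $C_\varphi^n$ is not posinormal.
   Context: $H^2$ is the Hilbert space of analytic functions $f(z)=\sum_{n\ge 0}a_nz^n$ on $\mathbb{D}$ with $\|f\|^2=\sum|a_n|^2<\infty$, and $C_\varphi f=f\circ\varphi$ (bounded on $H^2$). A linear-fractional selfmap $\varphi$ of $\mathbb{D}$ is of parabolic type if its Denjoy-Wolff point $w$ lies on $\partial\mathbb{D}$ and $\varphi'(w)=1$; the Denjoy-Wolff point is the unique attracting fixed point in $\overline{\mathbb{D}}$, to which the iterates of $\varphi$ converge uniformly on compact subsets of $\mathbb{D}$. A bounded linear operator $A$ on a Hilbert space is posinormal if there is a positive operator $P$ with $AA^*=A^*PA$ (equivalently, $\operatorname{ran}A\subseteq\operatorname{ran}A^*$); $A$ is coposinormal if $A^*$ is posinormal. *)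

theory Defs
  imports "HOL-Complex_Analysis.Complex_Analysis"
begin

section \<open>Complex Hilbert spaces and operators on them\<close>

text \<open>The inner product is linear in the first argument. Extending \<^class>\<open>banach\<close>, the class
  comes with the norm topology, and \<open>norm_cinner\<close> says that the norm is the one induced by
  the inner product.\<close>

class complex_hilbert = banach +
  fixes scaleC :: "complex \<Rightarrow> 'a \<Rightarrow> 'a"  (infixr \<open>*\<^sub>C\<close> 75)
    and cinner :: "'a \<Rightarrow> 'a \<Rightarrow> complex"
  assumes scaleC_add_right: "c *\<^sub>C (x + y) = c *\<^sub>C x + c *\<^sub>C y"
    and scaleC_add_left: "(c + d) *\<^sub>C x = c *\<^sub>C x + d *\<^sub>C x"
    and scaleC_scaleC: "c *\<^sub>C d *\<^sub>C x = (c * d) *\<^sub>C x"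
    and scaleR_scaleC: "r *\<^sub>R x = complex_of_real r *\<^sub>C x"
    and cinner_commute: "cinner x y = cnj (cinner y x)"
    and cinner_add_left: "cinner (x + y) z = cinner x z + cinner y z"
    and cinner_scaleC_left: "cinner (c *\<^sub>C x) y = c * cinner x y"
    and norm_cinner: "complex_of_real ((norm x)\<^sup>2) = cinner x x"

definition bounded_clinear :: "('a::complex_hilbert \<Rightarrow> 'b::complex_hilbert) \<Rightarrow> bool" where
  "bounded_clinear A \<longleftrightarrow> bounded_linear A \<and> (\<forall>c x. A (c *\<^sub>C x) = c *\<^sub>C A x)"

text \<open>The operator \<open>B\<close> below is unique, and by the Riesz representation theorem it exists
  whenever \<^term>\<open>A\<close> is bounded and complex-linear.\<close>

definition cadjoint :: "('a::complex_hilbert \<Rightarrow> 'b::complex_hilbert) \<Rightarrow> 'b \<Rightarrow> 'a" where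
  "cadjoint A = (THE B. \<forall>x y. cinner (A x) y = cinner x (B y))"

definition positive_operator :: "('a::complex_hilbert \<Rightarrow> 'a) \<Rightarrow> bool" where
  "positive_operator P \<longleftrightarrow> bounded_clinear P \<and> (\<forall>x. cinner (P x) x \<in> \<real>\<^sub>\<ge>\<^sub>0)"

definition posinormal :: "('a::complex_hilbert \<Rightarrow> 'a) \<Rightarrow> bool" where
  "posinormal A \<longleftrightarrow> bounded_clinear A \<and>
     (\<exists>P. positive_operator P \<and> A \<circ> cadjoint A = cadjoint A \<circ> P \<circ> A)"

definition coposinormal :: "('a::complex_hilbert \<Rightarrow> 'a) \<Rightarrow> bool" where
  "coposinormal A \<longleftrightarrow> bounded_clinear A \<and> posinormal (cadjoint A)"


section \<open>The Hardy space of the unit disk\<close>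

text \<open>Functions on the disk are represented by functions on the whole plane that are 0
  outside the disk, so that equality in the type is equality on the disk. The coefficients
  of \<^term>\<open>fps_expansion f 0\<close> are the Taylor coefficients of \<^term>\<open>f\<close> at 0.\<close>

definition l2 :: "(nat \<Rightarrow> complex) \<Rightarrow> bool" where
  "l2 a \<longleftrightarrow> summable (\<lambda>n. (cmod (a n))\<^sup>2)"

typedef hardy =
  "{f :: complex \<Rightarrow> complex. f holomorphic_on ball 0 1 \<and> (\<forall>z. z \<notin> ball 0 1 \<longrightarrow> f z = 0) \<and>
      l2 (fps_nth (fps_expansion f 0))}"
  morphisms hardy_fun Abs_hardy
proof -
  have "fps_expansion (\<lambda>_. 0) 0 = 0"
    by (rule fps_expansion_eqI) simp
  then show ?thesis
    by (intro exI[of _ "\<lambda>_. 0"]) (simp add: l2_def)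
qed

definition hardy_coeff :: "hardy \<Rightarrow> nat \<Rightarrow> complex" where
  "hardy_coeff f = fps_nth (fps_expansion (hardy_fun f) 0)"

definition hardy_of_coeff :: "(nat \<Rightarrow> complex) \<Rightarrow> hardy" where
  "hardy_of_coeff a = Abs_hardy (\<lambda>z. if z \<in> ball 0 1 then eval_fps (Abs_fps a) z else 0)"

lemma l2_hardy_coeff: "l2 (hardy_coeff f)"
  using hardy_fun[of f] by (simp add: hardy_coeff_def)

lemma hardy_fun_outside: "z \<notin> ball 0 1 \<Longrightarrow> hardy_fun f z = 0"
  using hardy_fun[of f] by simp

lemma hardy_fun_holomorphic: "hardy_fun f holomorphic_on ball 0 1"
  using hardy_fun[of f] by simp

lemma hardy_fun_sums:
  assumes "z \<in> ball 0 1"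
  shows "(\<lambda>n. hardy_coeff f n * z ^ n) sums hardy_fun f z"
  using holomorphic_power_series[OF hardy_fun_holomorphic assms, of f]
  by (simp add: hardy_coeff_def fps_expansion_def)

lemma hardy_coeff_eqI:
  assumes "\<And>n. hardy_coeff f n = hardy_coeff g n"
  shows "f = g"
proof -
  have "hardy_fun f z = hardy_fun g z" for z
  proof (cases "z \<in> ball 0 1")
    case True
    have "(\<lambda>n. hardy_coeff f n * z ^ n) sums hardy_fun g z"
      using hardy_fun_sums[OF True, of g] assms by simp
    then show ?thesis
      using hardy_fun_sums[OF True, of f] sums_unique2 by blast
  qed (simp add: hardy_fun_outside)
  then show ?thesis
    using hardy_fun_inject by blast
qed

lemma l2_conv_radius:
  assumes "l2 a"
  shows "fps_conv_radius (Abs_fps a) \<ge> 1"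
proof -
  have "(\<lambda>n. (cmod (a n))\<^sup>2) \<longlonglongrightarrow> 0"
    using assms unfolding l2_def by (rule summable_LIMSEQ_zero)
  then have "(\<lambda>n. sqrt ((cmod (a n))\<^sup>2)) \<longlonglongrightarrow> sqrt 0"
    by (rule tendsto_real_sqrt)
  then have "(\<lambda>n. cmod (a n)) \<longlonglongrightarrow> 0" by simp
  then have "Bseq (\<lambda>n. cmod (a n))"
    by (meson convergentI convergent_imp_Bseq)
  then obtain K where K: "\<And>n. cmod (a n) \<le> K"
    by (auto simp: Bseq_def)
  have "conv_radius a \<ge> 1"
  proof (rule conv_radius_geI_ex')
    fix r :: real assume r: "0 < r" "ereal r < 1"
    then have "summable (\<lambda>n. K * r ^ n)"
      by (intro summable_mult summable_geometric) auto
    then show "summable (\<lambda>n. a n * of_real r ^ n)"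
      by (rule summable_comparison_test'[where N = 0])
        (use r K in \<open>auto simp: norm_mult norm_power intro!: mult_right_mono\<close>)
  qed
  then show ?thesis
    by (simp add: fps_conv_radius_def)
qed

lemma hardy_coeff_of_coeff:
  assumes "l2 a"
  shows "hardy_coeff (hardy_of_coeff a) = a"
proof -
  define f where "f = (\<lambda>z. if z \<in> ball 0 1 then eval_fps (Abs_fps a) z else 0)"
  have R: "fps_conv_radius (Abs_fps a) \<ge> 1"
    using assms by (rule l2_conv_radius)
  have "eval_fps (Abs_fps a) holomorphic_on ball 0 1"
  proof (rule holomorphic_on_eval_fps)
    show "ball (0::complex) 1 \<subseteq> eball 0 (fps_conv_radius (Abs_fps a))"
    proof (rule subsetI)
      fix z :: complex assume "z \<in> ball 0 1"
      then have "ereal (dist 0 z) < 1" by simp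
      then have "ereal (dist 0 z) < fps_conv_radius (Abs_fps a)"
        using R by (rule less_le_trans)
      then show "z \<in> eball 0 (fps_conv_radius (Abs_fps a))" by simp
    qed
  qed
  then have hol: "f holomorphic_on ball 0 1"
    by (rule holomorphic_transform) (simp add: f_def)
  have "\<forall>\<^sub>F z in nhds 0. z \<in> ball (0::complex) 1"
    by (intro eventually_nhds_in_open) auto
  then have "\<forall>\<^sub>F z in nhds 0. eval_fps (Abs_fps a) z = f z"
    by (auto elim!: eventually_mono simp: f_def)
  moreover have "fps_conv_radius (Abs_fps a) > 0"
    using R by (rule less_le_trans[rotated]) simp
  ultimately have "f has_fps_expansion Abs_fps a"
    by (simp add: has_fps_expansion_def)
  then have "fps_expansion f 0 = Abs_fps a"
    by (rule fps_expansion_eqI)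
  then have e: "fps_nth (fps_expansion f 0) = a"
    by (simp add: fun_eq_iff)
  have "f z = 0" if "z \<notin> ball 0 1" for z
    using that unfolding f_def by (rule if_not_P)
  then have "hardy_fun (Abs_hardy f) = f"
    using hol assms e by (intro Abs_hardy_inverse) blast
  then show ?thesis
    unfolding hardy_coeff_def hardy_of_coeff_def f_def[symmetric] using e by simp
qed

lemma l2_add_bound: "(cmod (x + y))\<^sup>2 \<le> 2 * (cmod x)\<^sup>2 + 2 * (cmod y)\<^sup>2"
proof -
  have "(cmod (x + y))\<^sup>2 \<le> (cmod x + cmod y)\<^sup>2"
    by (intro power_mono norm_triangle_ineq) auto
  also have "\<dots> \<le> 2 * (cmod x)\<^sup>2 + 2 * (cmod y)\<^sup>2"
    using sum_squares_bound[of "cmod x" "cmod y"] by (simp add: power2_sum)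
  finally show ?thesis .
qed

lemma l2_zero: "l2 (\<lambda>_. 0)"
  by (simp add: l2_def)

lemma l2_add:
  assumes "l2 a" "l2 b"
  shows "l2 (\<lambda>n. a n + b n)"
proof -
  have "summable (\<lambda>n. 2 * (cmod (a n))\<^sup>2 + 2 * (cmod (b n))\<^sup>2)"
    using assms by (intro summable_add summable_mult) (auto simp: l2_def)
  then show ?thesis
    unfolding l2_def
    by (rule summable_comparison_test'[where N = 0]) (simp add: l2_add_bound)
qed

lemma l2_cmult: "l2 a \<Longrightarrow> l2 (\<lambda>n. c * a n)"
  by (auto simp: l2_def norm_mult power_mult_distrib intro: summable_mult)

lemma l2_uminus: "l2 a \<Longrightarrow> l2 (\<lambda>n. - a n)"
  by (simp add: l2_def)

lemma l2_diff: "l2 a \<Longrightarrow> l2 b \<Longrightarrow> l2 (\<lambda>n. a n - b n)"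
  using l2_add[of a "\<lambda>n. - b n"] by (simp add: l2_uminus)

lemma l2_inner_summable:
  assumes "l2 a" "l2 b"
  shows "summable (\<lambda>n. a n * cnj (b n))"
proof -
  have "summable (\<lambda>n. (cmod (a n))\<^sup>2 + (cmod (b n))\<^sup>2)"
    using assms by (intro summable_add) (auto simp: l2_def)
  then show ?thesis
  proof (rule summable_comparison_test'[where N = 0])
    fix n
    show "norm (a n * cnj (b n)) \<le> (cmod (a n))\<^sup>2 + (cmod (b n))\<^sup>2"
      using sum_squares_bound[of "cmod (a n)" "cmod (b n)"]
        mult_nonneg_nonneg[OF norm_ge_zero norm_ge_zero, of "a n" "b n"]
      unfolding norm_mult complex_mod_cnj by linarith
  qed
qed

text \<open>The vector space operations are defined on Taylor coefficients; the lemma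
  \<open>hardy_fun_simps\<close> below shows that they are the pointwise ones.\<close>

instantiation hardy :: real_normed_vector
begin

definition "0 = hardy_of_coeff (\<lambda>_. 0)"
definition "f + g = hardy_of_coeff (\<lambda>n. hardy_coeff f n + hardy_coeff g n)"
definition "- f = hardy_of_coeff (\<lambda>n. - hardy_coeff f n)"
definition "f - g = hardy_of_coeff (\<lambda>n. hardy_coeff f n - hardy_coeff g n)"
definition "r *\<^sub>R f = hardy_of_coeff (\<lambda>n. complex_of_real r * hardy_coeff f n)"
definition "norm f = sqrt (\<Sum>n. (cmod (hardy_coeff f n))\<^sup>2)"
definition "sgn (f :: hardy) = scaleR (inverse (norm f)) f"
definition "dist (f :: hardy) g = norm (f - g)"
definition "(uniformity :: (hardy \<times> hardy) filter) =
  (INF e\<in>{0 <..}. principal {(x, y). dist x y < e})"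
definition "open (U :: hardy set) \<longleftrightarrow>
  (\<forall>x\<in>U. \<forall>\<^sub>F (x', y) in uniformity. x' = x \<longrightarrow> y \<in> U)"

lemma hardy_coeff_simps [simp]:
  "hardy_coeff 0 n = 0"
  "hardy_coeff (f + g) n = hardy_coeff f n + hardy_coeff g n"
  "hardy_coeff (- f) n = - hardy_coeff f n"
  "hardy_coeff (f - g) n = hardy_coeff f n - hardy_coeff g n"
  "hardy_coeff (r *\<^sub>R f) n = complex_of_real r * hardy_coeff f n"
  unfolding zero_hardy_def plus_hardy_def uminus_hardy_def minus_hardy_def scaleR_hardy_def
  by (simp_all add: hardy_coeff_of_coeff l2_zero l2_add l2_uminus l2_diff l2_cmult
      l2_hardy_coeff)

lemma hardy_norm_summable: "summable (\<lambda>n. (cmod (hardy_coeff f n))\<^sup>2)"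
  using l2_hardy_coeff by (simp add: l2_def)

lemma hardy_norm_power2: "(norm f)\<^sup>2 = (\<Sum>n. (cmod (hardy_coeff f n))\<^sup>2)"
  unfolding norm_hardy_def by (intro real_sqrt_pow2 suminf_nonneg hardy_norm_summable) simp

lemma hardy_norm_partial:
  fixes f :: hardy
  shows "L2_set (\<lambda>n. cmod (hardy_coeff f n)) {..<N} \<le> norm f"
  unfolding L2_set_def norm_hardy_def
  by (intro real_sqrt_le_mono sum_le_suminf hardy_norm_summable) auto

lemma hardy_norm_leI:
  fixes f :: hardy
  assumes "\<And>N. L2_set (\<lambda>n. cmod (hardy_coeff f n)) {..<N} \<le> K"
  shows "norm f \<le> K"
proof -
  have K: "K \<ge> 0" using assms[of 0] by simp
  have "(\<Sum>n. (cmod (hardy_coeff f n))\<^sup>2) \<le> K\<^sup>2"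
  proof (rule suminf_le_const[OF hardy_norm_summable])
    fix N
    show "(\<Sum>n<N. (cmod (hardy_coeff f n))\<^sup>2) \<le> K\<^sup>2"
      using assms[of N] by (intro sqrt_le_D) (simp add: L2_set_def)
  qed
  then show ?thesis
    unfolding norm_hardy_def using K by (simp add: real_le_lsqrt)
qed

lemma hardy_coeff_le_norm: "cmod (hardy_coeff f n) \<le> norm f"
proof -
  have "cmod (hardy_coeff f n) \<le> L2_set (\<lambda>n. cmod (hardy_coeff f n)) {..<Suc n}"
    by (rule member_le_L2_set) auto
  then show ?thesis
    using hardy_norm_partial order_trans by blast
qed

instance
proof
  fix f g h :: hardy and r s :: real
  show "f + g + h = f + (g + h)" "f + g = g + f" "0 + f = f" "- f + f = 0" "f - g = f + - g"
    "r *\<^sub>R (f + g) = r *\<^sub>R f + r *\<^sub>R g" "(r + s) *\<^sub>R f = r *\<^sub>R f + s *\<^sub>R f"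
    "r *\<^sub>R s *\<^sub>R f = (r * s) *\<^sub>R f" "1 *\<^sub>R f = f"
    by (rule hardy_coeff_eqI; simp add: algebra_simps)+
  show "sgn f = inverse (norm f) *\<^sub>R f" by (rule sgn_hardy_def)
  show "dist f g = norm (f - g)" by (rule dist_hardy_def)
  show "(uniformity :: (hardy \<times> hardy) filter) =
      (INF e\<in>{0 <..}. principal {(x, y). dist x y < e})"
    by (rule uniformity_hardy_def)
  show "open U \<longleftrightarrow> (\<forall>x\<in>U. \<forall>\<^sub>F (x', y) in uniformity. x' = x \<longrightarrow> y \<in> U)" for U :: "hardy set"
    by (rule open_hardy_def)
  show "norm f = 0 \<longleftrightarrow> f = 0"
  proof
    assume "norm f = 0"
    then have "hardy_coeff f n = 0" for n
      using hardy_coeff_le_norm[of f n] by simp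
    then show "f = 0"
      by (intro hardy_coeff_eqI) simp
  qed (simp add: norm_hardy_def)
  show "norm (f + g) \<le> norm f + norm g"
  proof (rule hardy_norm_leI)
    fix N
    have "L2_set (\<lambda>n. cmod (hardy_coeff (f + g) n)) {..<N}
        \<le> L2_set (\<lambda>n. cmod (hardy_coeff f n) + cmod (hardy_coeff g n)) {..<N}"
      by (rule L2_set_mono) (auto intro: norm_triangle_ineq)
    also have "\<dots> \<le> L2_set (\<lambda>n. cmod (hardy_coeff f n)) {..<N}
        + L2_set (\<lambda>n. cmod (hardy_coeff g n)) {..<N}"
      by (rule L2_set_triangle_ineq)
    also have "\<dots> \<le> norm f + norm g"
      by (intro add_mono hardy_norm_partial)
    finally show "L2_set (\<lambda>n. cmod (hardy_coeff (f + g) n)) {..<N} \<le> norm f + norm g" .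
  qed
  show "norm (r *\<^sub>R f) = \<bar>r\<bar> * norm f"
  proof -
    have "(\<Sum>n. (cmod (hardy_coeff (r *\<^sub>R f) n))\<^sup>2)
        = (\<Sum>n. r\<^sup>2 * (cmod (hardy_coeff f n))\<^sup>2)"
      by (simp add: norm_mult power_mult_distrib)
    also have "\<dots> = r\<^sup>2 * (\<Sum>n. (cmod (hardy_coeff f n))\<^sup>2)"
      by (rule suminf_mult[OF hardy_norm_summable])
    finally show ?thesis
      unfolding norm_hardy_def by (simp only: real_sqrt_mult real_sqrt_abs)
  qed
qed

end

instance hardy :: banach
proof
  fix X :: "nat \<Rightarrow> hardy"
  assume "Cauchy X"
  then have X: "\<exists>M. \<forall>m\<ge>M. \<forall>n\<ge>M. norm (X m - X n) < e" if "e > 0" for e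
    using that unfolding Cauchy_def dist_hardy_def by blast
  have "Cauchy (\<lambda>m. hardy_coeff (X m) k)" for k
  proof (rule CauchyI)
    fix e :: real assume "e > 0"
    then obtain M where "\<forall>m\<ge>M. \<forall>n\<ge>M. norm (X m - X n) < e"
      using X by blast
    then have "\<forall>m\<ge>M. \<forall>n\<ge>M. cmod (hardy_coeff (X m - X n) k) < e"
      using hardy_coeff_le_norm le_less_trans by blast
    then show "\<exists>M. \<forall>m\<ge>M. \<forall>n\<ge>M. cmod (hardy_coeff (X m) k - hardy_coeff (X n) k) < e"
      by auto
  qed
  then have "\<exists>b. (\<lambda>m. hardy_coeff (X m) k) \<longlonglongrightarrow> b" for k
    by (simp add: Cauchy_convergent_iff convergent_def)
  then obtain b where b: "\<And>k. (\<lambda>m. hardy_coeff (X m) k) \<longlonglongrightarrow> b k"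
    by metis
  have bound: "\<exists>M. \<forall>m\<ge>M. \<forall>N. L2_set (\<lambda>k. cmod (hardy_coeff (X m) k - b k)) {..<N} \<le> e"
    if "e > 0" for e
  proof -
    obtain M where M: "\<forall>m\<ge>M. \<forall>n\<ge>M. norm (X m - X n) < e"
      using X[OF \<open>e > 0\<close>] by blast
    have "L2_set (\<lambda>k. cmod (hardy_coeff (X m) k - b k)) {..<N} \<le> e" if "m \<ge> M" for m N
    proof (rule tendsto_upperbound)
      show "(\<lambda>n. L2_set (\<lambda>k. cmod (hardy_coeff (X m - X n) k)) {..<N})
          \<longlonglongrightarrow> L2_set (\<lambda>k. cmod (hardy_coeff (X m) k - b k)) {..<N}"
        unfolding L2_set_def hardy_coeff_simps by (intro tendsto_intros b)
      show "\<forall>\<^sub>F n in sequentially. L2_set (\<lambda>k. cmod (hardy_coeff (X m - X n) k)) {..<N} \<le> e"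
        using eventually_ge_at_top[of M]
      proof eventually_elim
        case (elim n)
        then have "norm (X m - X n) < e"
          using M that by blast
        then show ?case
          using hardy_norm_partial[of "X m - X n" N] by linarith
      qed
    qed simp
    then show ?thesis by blast
  qed
  have "l2 b"
  proof -
    obtain m where m: "\<And>N. L2_set (\<lambda>k. cmod (hardy_coeff (X m) k - b k)) {..<N} \<le> 1"
      using bound[of 1] by auto
    have "l2 (\<lambda>k. hardy_coeff (X m) k - b k)"
      unfolding l2_def
    proof (rule bounded_imp_summable)
      fix N
      show "(\<Sum>k\<le>N. (cmod (hardy_coeff (X m) k - b k))\<^sup>2) \<le> 1"
        using m[of "Suc N"] by (simp add: L2_set_def lessThan_Suc_atMost)
    qed simp
    from l2_diff[OF l2_hardy_coeff this, of "X m"] show ?thesis by simp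
  qed
  then have L: "hardy_coeff (hardy_of_coeff b) = b"
    by (rule hardy_coeff_of_coeff)
  have "X \<longlonglongrightarrow> hardy_of_coeff b"
  proof (rule metric_LIMSEQ_I)
    fix e :: real assume "e > 0"
    then obtain M where
      M: "\<forall>m\<ge>M. \<forall>N. L2_set (\<lambda>k. cmod (hardy_coeff (X m) k - b k)) {..<N} \<le> e / 2"
      using bound[of "e / 2"] by auto
    have "dist (X m) (hardy_of_coeff b) \<le> e / 2" if "m \<ge> M" for m
      unfolding dist_hardy_def using M that by (intro hardy_norm_leI) (auto simp: L)
    then show "\<exists>M. \<forall>m\<ge>M. dist (X m) (hardy_of_coeff b) < e"
      using \<open>e > 0\<close> by (smt (verit) field_sum_of_halves)
  qed
  then show "convergent X"
    by (auto simp: convergent_def)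
qed

instantiation hardy :: complex_hilbert
begin

definition "c *\<^sub>C f = hardy_of_coeff (\<lambda>n. c * hardy_coeff f n)"
definition "cinner f g = (\<Sum>n. hardy_coeff f n * cnj (hardy_coeff g n))"

lemma hardy_coeff_scaleC [simp]: "hardy_coeff (c *\<^sub>C f) n = c * hardy_coeff f n"
  unfolding scaleC_hardy_def by (simp add: hardy_coeff_of_coeff l2_cmult l2_hardy_coeff)

lemma hardy_cinner_self: "complex_of_real ((norm f)\<^sup>2) = cinner (f::hardy) f"
proof -
  have "(\<lambda>n. complex_of_real ((cmod (hardy_coeff f n))\<^sup>2)) sums complex_of_real ((norm f)\<^sup>2)"
    unfolding hardy_norm_power2 by (intro sums_of_real summable_sums hardy_norm_summable)
  then show ?thesis
    unfolding cinner_hardy_def complex_norm_square[symmetric] by (rule sums_unique)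
qed

instance
proof
  fix f g h :: hardy and c d :: complex and r :: real
  show "c *\<^sub>C (f + g) = c *\<^sub>C f + c *\<^sub>C g" "(c + d) *\<^sub>C f = c *\<^sub>C f + d *\<^sub>C f"
    "c *\<^sub>C d *\<^sub>C f = (c * d) *\<^sub>C f" "r *\<^sub>R f = complex_of_real r *\<^sub>C f"
    by (rule hardy_coeff_eqI; simp add: algebra_simps)+
  show "complex_of_real ((norm f)\<^sup>2) = cinner f f"
    by (rule hardy_cinner_self)
  have S: "summable (\<lambda>n. hardy_coeff f n * cnj (hardy_coeff g n))" for f g
    by (rule l2_inner_summable[OF l2_hardy_coeff l2_hardy_coeff])
  show "cinner f g = cnj (cinner g f)"
  proof -
    have "(\<lambda>n. cnj (hardy_coeff g n * cnj (hardy_coeff f n))) sums cnj (cinner g f)"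
      unfolding sums_cnj cinner_hardy_def by (rule summable_sums[OF S])
    then have "(\<lambda>n. hardy_coeff f n * cnj (hardy_coeff g n)) sums cnj (cinner g f)"
      by (simp only: complex_cnj_mult complex_cnj_cnj mult.commute)
    then show ?thesis
      unfolding cinner_hardy_def[of f g] by (rule sums_unique[symmetric])
  qed
  show "cinner (f + g) h = cinner f h + cinner g h"
    unfolding cinner_hardy_def hardy_coeff_simps distrib_right by (rule suminf_add[symmetric, OF S S])
  show "cinner (c *\<^sub>C f) g = c * cinner f g"
    unfolding cinner_hardy_def hardy_coeff_scaleC mult.assoc by (rule suminf_mult[OF S])
qed

end

lemma hardy_fun_simps:
  "hardy_fun 0 z = 0"
  "hardy_fun (f + g) z = hardy_fun f z + hardy_fun g z"
  "hardy_fun (c *\<^sub>C f) z = c * hardy_fun f z"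
proof -
  have "hardy_fun 0 z = 0 \<and> hardy_fun (f + g) z = hardy_fun f z + hardy_fun g z \<and>
    hardy_fun (c *\<^sub>C f) z = c * hardy_fun f z"
  proof (cases "z \<in> ball 0 1")
    case True
    note S = hardy_fun_sums[OF True]
    have "(\<lambda>n. 0) sums hardy_fun 0 z"
      using S[of 0] by simp
    moreover have "(\<lambda>n. hardy_coeff f n * z ^ n + hardy_coeff g n * z ^ n)
        sums hardy_fun (f + g) z"
      using S[of "f + g"] by (simp add: distrib_right)
    moreover have "(\<lambda>n. c * (hardy_coeff f n * z ^ n)) sums hardy_fun (c *\<^sub>C f) z"
      using S[of "c *\<^sub>C f"] by (simp add: mult.assoc)
    ultimately show ?thesis
      using sums_add[OF S[of f] S[of g]] sums_mult[OF S[of f], of c]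
      by (auto intro: sums_unique2[OF _ sums_zero] sums_unique2)
  qed (simp add: hardy_fun_outside)
  then show "hardy_fun 0 z = 0" "hardy_fun (f + g) z = hardy_fun f z + hardy_fun g z"
    "hardy_fun (c *\<^sub>C f) z = c * hardy_fun f z"
    by auto
qed


section \<open>Composition operators and linear-fractional selfmaps\<close>

text \<open>If \<^term>\<open>\<phi>\<close> is a holomorphic selfmap of the disk then, by Littlewood's subordination
  principle, the function passed to \<^const>\<open>Abs_hardy\<close> is always in the Hardy space.\<close>

definition composition_operator :: "(complex \<Rightarrow> complex) \<Rightarrow> hardy \<Rightarrow> hardy" where
  "composition_operator \<phi> f = Abs_hardy (\<lambda>z. if z \<in> ball 0 1 then hardy_fun f (\<phi> z) else 0)"

text \<open>The formula is required on the whole plane (and not just on the disk) so that values and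
  derivatives on the unit circle are those of the linear-fractional map. Such a selfmap of the
  disk has no pole on the closed disk, so the value that division by zero gives at a pole
  is irrelevant.\<close>

definition linear_fractional_selfmap :: "(complex \<Rightarrow> complex) \<Rightarrow> bool" where
  "linear_fractional_selfmap \<phi> \<longleftrightarrow>
     (\<exists>a b c d. a * d - b * c \<noteq> 0 \<and> (\<forall>z\<in>ball 0 1. c * z + d \<noteq> 0) \<and>
        (\<forall>z. \<phi> z = (a * z + b) / (c * z + d))) \<and>
     \<phi> ` ball 0 1 \<subseteq> ball 0 1"

definition denjoy_wolff_point :: "(complex \<Rightarrow> complex) \<Rightarrow> complex \<Rightarrow> bool" where
  "denjoy_wolff_point \<phi> w \<longleftrightarrow> w \<in> cball 0 1 \<and> \<phi> w = w \<and>
     (\<forall>K. compact K \<and> K \<subseteq> ball 0 1 \<longrightarrow> uniform_limit K (\<lambda>n. \<phi> ^^ n) (\<lambda>_. w) sequentially)"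

definition parabolic_type :: "(complex \<Rightarrow> complex) \<Rightarrow> bool" where
  "parabolic_type \<phi> \<longleftrightarrow>
     (\<exists>w. denjoy_wolff_point \<phi> w \<and> w \<in> sphere 0 1 \<and> (\<phi> has_field_derivative 1) (at w))"

definition disk_automorphism :: "(complex \<Rightarrow> complex) \<Rightarrow> bool" where
  "disk_automorphism \<phi> \<longleftrightarrow> \<phi> holomorphic_on ball 0 1 \<and> bij_betw \<phi> (ball 0 1) (ball 0 1)"

end

theory Submission
  imports Defs
begin

text \<open>In the coordinate \<open>1 / (1 - cnj w * z)\<close>, where \<open>w\<close> is the Denjoy-Wolff point, \<open>\<phi>\<close> is a
  translation by some \<open>\<tau>\<close> with \<open>Re \<tau> > 0\<close>, and \<open>\<phi>\<close> vanishes in the disk iff \<open>Re \<tau> < 1 / 2\<close>. By Cowen's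
  formula the adjoint of \<open>C\<^sub>\<phi>\<close> is \<open>C\<^sub>\<sigma> T\<^sub>g T\<^sub>h\<^sup>*\<close>, where \<open>\<sigma>\<close> is the translation by \<open>cnj \<tau>\<close> and \<open>g\<close>, \<open>h\<close> are
  linear polynomials without zeros on the closed disk (for \<open>g\<close> this needs \<open>Re \<tau> < 1 / 2\<close>), so
  that \<open>T\<^sub>g\<close> and \<open>T\<^sub>h\<close> are invertible. Since \<open>\<phi>\<close> and \<open>\<sigma>\<close> differ by an imaginary translation, which is
  an automorphism of the disk, \<open>C\<^sub>\<phi>\<close> and its adjoint are right multiples of each other.

  The power \<open>C\<^sub>\<phi>\<^sup>n\<close> belongs to the translation by \<open>n * \<tau>\<close>. Once \<open>n * Re \<tau> > 1 / 2\<close> the closure of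
  the image of the disk misses 0, so there are polynomials \<open>p\<^sub>k\<close> with \<open>p\<^sub>k 0 = 1\<close> and \<open>C\<^sub>\<phi>\<^sup>n p\<^sub>k\<close>
  tending to 0. Posinormality would force the adjoint to map \<open>p\<^sub>k\<close> to a null sequence as well,
  although its inner product with the constant 1 is \<open>p\<^sub>k 0\<close>.\<close>

section \<open>Adjoints in complex Hilbert spaces\<close>

lemma cinner_add_right: "cinner x (y + z) = cinner x y + cinner (x::'a::complex_hilbert) z"
  by (metis cinner_commute cinner_add_left complex_cnj_add)

lemma cinner_scaleC_right: "cinner x (c *\<^sub>C y) = cnj c * cinner (x::'a::complex_hilbert) y"
  by (metis cinner_commute cinner_scaleC_left complex_cnj_mult)

lemma scaleC_minus_one: "(-1) *\<^sub>C x = - (x::'a::complex_hilbert)"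
  using scaleR_scaleC[of "-1" x] by simp

lemma scaleC_one: "1 *\<^sub>C x = (x::'a::complex_hilbert)"
  using scaleR_scaleC[of 1 x] by simp

lemma cinner_minus_right: "cinner x (- y) = - cinner (x::'a::complex_hilbert) y"
  using cinner_scaleC_right[of x "-1" y] by (simp add: scaleC_minus_one)

lemma cinner_diff_right: "cinner x (y - z) = cinner x y - cinner (x::'a::complex_hilbert) z"
  using cinner_add_right[of x y "- z"] by (simp add: cinner_minus_right)

lemma cinner_self_eq_0: "cinner x x = 0 \<Longrightarrow> (x::'a::complex_hilbert) = 0"
  by (metis norm_cinner of_real_eq_0_iff norm_eq_zero power_eq_0_iff)

lemma cinner_zero_right [simp]: "cinner (x::'a::complex_hilbert) 0 = 0"
  by (metis cinner_diff_right diff_self)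

lemma cinner_right_eqI:
  fixes y z :: "'a::complex_hilbert"
  assumes "\<And>x. cinner x y = cinner x z"
  shows "y = z"
  using cinner_self_eq_0[of "y - z"] assms[of "y - z"] by (simp add: cinner_diff_right)

lemma norm_scaleC: "norm (c *\<^sub>C x) = cmod c * norm (x::'a::complex_hilbert)"
proof -
  have "complex_of_real ((norm (c *\<^sub>C x))\<^sup>2) = complex_of_real ((cmod c * norm x)\<^sup>2)"
    unfolding norm_cinner cinner_scaleC_left cinner_scaleC_right
    by (simp only: power_mult_distrib of_real_mult complex_norm_square norm_cinner mult_ac)
  then show ?thesis
    by (simp only: of_real_eq_iff) (simp add: power2_eq_iff_nonneg)
qed

lemma norm_add_scaleC_power2:
  fixes x y :: "'a::complex_hilbert"
  shows "(norm (a *\<^sub>C x + b *\<^sub>C y))\<^sup>2 =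
    (cmod a)\<^sup>2 * (norm x)\<^sup>2 + (cmod b)\<^sup>2 * (norm y)\<^sup>2 + 2 * Re (a * cnj b * cinner x y)"
proof -
  have "complex_of_real ((norm (a *\<^sub>C x + b *\<^sub>C y))\<^sup>2) =
      (a * cnj a) * cinner x x + (b * cnj b) * cinner y y
      + (a * cnj b * cinner x y + cnj (a * cnj b * cinner x y))"
    unfolding norm_cinner cinner_add_left cinner_add_right cinner_scaleC_left cinner_scaleC_right
    using cinner_commute[of y x] by (simp add: algebra_simps)
  also have "\<dots> = complex_of_real ((cmod a)\<^sup>2 * (norm x)\<^sup>2 + (cmod b)\<^sup>2 * (norm y)\<^sup>2
      + 2 * Re (a * cnj b * cinner x y))"
    unfolding complex_add_cnj norm_cinner[symmetric] complex_norm_square[symmetric] by simp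
  finally show ?thesis
    by (simp only: of_real_eq_iff)
qed

lemma norm_add_power2:
  fixes x y :: "'a::complex_hilbert"
  shows "(norm (x + y))\<^sup>2 = (norm x)\<^sup>2 + (norm y)\<^sup>2 + 2 * Re (cinner x y)"
  using norm_add_scaleC_power2[of 1 x 1 y] by (simp add: scaleC_one)

lemma cinner_Cauchy_Schwarz:
  fixes x y :: "'a::complex_hilbert"
  shows "cmod (cinner x y) \<le> norm x * norm y"
proof (cases "y = 0")
  case False
  \<comment> \<open>With this \<open>c\<close> the vector \<open>x + c y\<close> is the component of
    \<open>x\<close> orthogonal to \<open>y\<close>; nonnegativity of its squared norm is the
    inequality.\<close>
  define c where "c = - cinner x y / of_real ((norm y)\<^sup>2)"
  have ny: "(norm y)\<^sup>2 > 0" using False by simp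
  have e: "cnj c * cinner x y = - of_real ((cmod (cinner x y))\<^sup>2 / (norm y)\<^sup>2)"
    unfolding c_def of_real_divide complex_norm_square by simp
  have m: "(cmod c)\<^sup>2 * (norm y)\<^sup>2 = (cmod (cinner x y))\<^sup>2 / (norm y)\<^sup>2"
    unfolding c_def norm_divide norm_of_real norm_minus_cancel using ny
    by (simp add: power_divide power2_eq_square)
  have "0 \<le> (norm (1 *\<^sub>C x + c *\<^sub>C y))\<^sup>2" by simp
  also have "\<dots> = (norm x)\<^sup>2 - (cmod (cinner x y))\<^sup>2 / (norm y)\<^sup>2"
    unfolding norm_add_scaleC_power2 using m e by simp
  finally have "(cmod (cinner x y))\<^sup>2 \<le> (norm x * norm y)\<^sup>2"
    using ny by (simp add: field_simps power_mult_distrib)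
  then show ?thesis
    by (rule power2_le_imp_le) simp
qed simp

lemma bounded_clinearI:
  fixes A :: "'a::complex_hilbert \<Rightarrow> 'b::complex_hilbert"
  assumes "\<And>x y. A (x + y) = A x + A y" and "\<And>c x. A (c *\<^sub>C x) = c *\<^sub>C A x"
    and "\<And>x. norm (A x) \<le> K * norm x"
  shows "bounded_clinear A"
  unfolding bounded_clinear_def
proof
  show "bounded_linear A"
    using assms by (intro bounded_linear_intro[where K = K]) (simp_all add: scaleR_scaleC mult.commute)
qed (use assms in auto)

lemma bounded_clinear_bounded_linear: "bounded_clinear A \<Longrightarrow> bounded_linear A"
  by (simp add: bounded_clinear_def)

lemma bounded_clinear_scaleC: "bounded_clinear A \<Longrightarrow> A (c *\<^sub>C x) = c *\<^sub>C A x"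
  by (simp add: bounded_clinear_def)

lemma bounded_clinear_bound:
  assumes "bounded_clinear A"
  obtains K where "K \<ge> 0" "\<And>x. norm (A x) \<le> K * norm x"
  using bounded_linear.nonneg_bounded[OF bounded_clinear_bounded_linear[OF assms]]
  by (metis mult.commute)

lemma bounded_clinear_comp:
  "bounded_clinear A \<Longrightarrow> bounded_clinear B \<Longrightarrow> bounded_clinear (A \<circ> B)"
  unfolding bounded_clinear_def by (auto simp: o_def intro: bounded_linear_compose)

lemma bounded_clinear_funpow:
  fixes A :: "'a::complex_hilbert \<Rightarrow> 'a"
  assumes "bounded_clinear A"
  shows "bounded_clinear (A ^^ n)"
proof (induction n)
  case 0
  show ?case by (rule bounded_clinearI[where K = 1]) auto
next
  case (Suc n)
  then show ?case using bounded_clinear_comp[OF assms] by (simp add: funpow.simps(2) del: o_apply)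
qed

section \<open>Adjoint pairs and criteria for posinormality\<close>

text \<open>\<open>cadjoint\<close> is a definite description, informative only once an adjoint is
  exhibited. The relation separates computing with an adjoint from its existence;
  \<open>adjoint_pair_cadjoint\<close> links the two.\<close>

definition adjoint_pair ::
    "('a::complex_hilbert \<Rightarrow> 'b::complex_hilbert) \<Rightarrow> ('b \<Rightarrow> 'a) \<Rightarrow> bool" where
  "adjoint_pair A B \<longleftrightarrow> (\<forall>x y. cinner (A x) y = cinner x (B y))"

lemma adjoint_pairD: "adjoint_pair A B \<Longrightarrow> cinner (A x) y = cinner x (B y)"
  by (simp add: adjoint_pair_def)

lemma adjoint_pair_unique:
  assumes "adjoint_pair A B" "adjoint_pair A B'"
  shows "B = B'"
proof
  fix y
  show "B y = B' y"
    by (rule cinner_right_eqI) (metis assms adjoint_pairD)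
qed

lemma adjoint_pair_cadjoint: "adjoint_pair A B \<Longrightarrow> cadjoint A = B"
  unfolding cadjoint_def adjoint_pair_def[symmetric]
  by (blast intro: the_equality adjoint_pair_unique)

lemma adjoint_pair_sym: "adjoint_pair A B \<Longrightarrow> adjoint_pair B A"
  unfolding adjoint_pair_def by (metis cinner_commute)

lemma adjoint_pair_comp:
  "adjoint_pair A A' \<Longrightarrow> adjoint_pair B B' \<Longrightarrow> adjoint_pair (A \<circ> B) (B' \<circ> A')"
  unfolding adjoint_pair_def by simp

lemma adjoint_pair_bounded_clinear:
  assumes A: "bounded_clinear A" and AB: "adjoint_pair A B"
  shows "bounded_clinear B"
proof -
  obtain K where K: "K \<ge> 0" "\<And>x. norm (A x) \<le> K * norm x"
    using bounded_clinear_bound[OF A] by metis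
  show ?thesis
  proof (rule bounded_clinearI)
    fix x y c
    show "B (x + y) = B x + B y"
      by (rule cinner_right_eqI) (simp add: cinner_add_right flip: adjoint_pairD[OF AB])
    show "B (c *\<^sub>C x) = c *\<^sub>C B x"
      by (rule cinner_right_eqI) (simp add: cinner_scaleC_right flip: adjoint_pairD[OF AB])
    have "(norm (B y))\<^sup>2 = cmod (cinner (B y) (B y))"
      by (simp add: norm_cinner[symmetric] norm_power)
    also have "\<dots> = cmod (cinner (A (B y)) y)"
      by (simp add: adjoint_pairD[OF AB])
    also have "\<dots> \<le> (K * norm (B y)) * norm y"
      by (rule order_trans[OF cinner_Cauchy_Schwarz]) (intro mult_right_mono K, simp)
    finally have "norm (B y) * norm (B y) \<le> norm (B y) * (K * norm y)"
      by (simp add: power2_eq_square mult_ac)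
    then show "norm (B y) \<le> K * norm y"
      using K by (cases "B y = 0") (auto simp: mult_le_cancel_left)
  qed
qed

text \<open>The easy half of Douglas's range inclusion criterion: taking adjoints in
  \<open>A = A' B\<close> gives \<open>A' = B' A\<close>, hence \<open>A A' = A' (B B') A\<close>,
  and \<open>P = B B'\<close> is positive.\<close>

lemma posinormal_factor:
  assumes A: "bounded_clinear A" and B: "bounded_clinear B"
    and AA': "adjoint_pair A A'" and BB': "adjoint_pair B B'" and f: "A = A' \<circ> B"
  shows "posinormal A"
proof -
  have A': "A' = B' \<circ> A"
    using adjoint_pair_unique[OF AA'] adjoint_pair_comp[OF adjoint_pair_sym[OF AA'] BB'] f by simp
  have "positive_operator (B \<circ> B')"
    unfolding positive_operator_def
  proof (intro conjI allI)
    show "bounded_clinear (B \<circ> B')"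
      using B adjoint_pair_bounded_clinear[OF B BB'] by (rule bounded_clinear_comp)
    fix x
    have "cinner ((B \<circ> B') x) x = complex_of_real ((norm (B' x))\<^sup>2)"
      by (simp only: o_apply adjoint_pairD[OF BB'] norm_cinner)
    then show "cinner ((B \<circ> B') x) x \<in> \<real>\<^sub>\<ge>\<^sub>0"
      by (simp only: nonneg_Reals_of_real_iff) simp
  qed
  moreover have "A \<circ> A' = A' \<circ> (B \<circ> B') \<circ> A"
    by (subst f, subst A') (simp add: o_assoc)
  ultimately show ?thesis
    unfolding posinormal_def adjoint_pair_cadjoint[OF AA'] using A by blast
qed

text \<open>The tool for refuting posinormality:
  \<open>|A' x|^2 = <A A' x, x> = <P A x, A x>\<close>, and \<open>P\<close> is bounded.\<close>

lemma posinormal_norm_bound: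
  assumes "posinormal A" and AA': "adjoint_pair A A'"
  obtains K where "K \<ge> 0" "\<And>x. norm (A' x) \<le> K * norm (A x)"
proof -
  obtain P where P: "positive_operator P" "A \<circ> A' = A' \<circ> P \<circ> A"
    using assms(1) unfolding posinormal_def adjoint_pair_cadjoint[OF AA'] by blast
  obtain K where K: "K \<ge> 0" "\<And>x. norm (P x) \<le> K * norm x"
    using bounded_clinear_bound P(1) unfolding positive_operator_def by metis
  have "norm (A' x) \<le> sqrt K * norm (A x)" for x
  proof -
    have "(norm (A' x))\<^sup>2 = cmod (cinner (A' x) (A' x))"
      by (simp add: norm_cinner[symmetric] norm_power)
    also have "\<dots> = cmod (cinner ((A \<circ> A') x) x)"
      by (simp add: adjoint_pairD[OF AA'])
    also have "\<dots> = cmod (cinner (P (A x)) (A x))"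
      unfolding P(2) by (simp add: adjoint_pairD[OF adjoint_pair_sym[OF AA']])
    also have "\<dots> \<le> (K * norm (A x)) * norm (A x)"
      by (rule order_trans[OF cinner_Cauchy_Schwarz]) (intro mult_right_mono K, simp)
    also have "\<dots> = (sqrt K * norm (A x))\<^sup>2"
      using K by (simp add: power_mult_distrib power2_eq_square)
    finally show ?thesis
      by (rule power2_le_imp_le) (use K in simp)
  qed
  then show thesis
    using K(1) that[of "sqrt K"] by simp
qed

section \<open>Kernels, multiplication operators and adjoints on the Hardy space\<close>

lemma hardy_fun_eqI:
  assumes "\<And>z. z \<in> ball 0 1 \<Longrightarrow> hardy_fun f z = hardy_fun g z"
  shows "f = g"
proof -
  have "hardy_fun f z = hardy_fun g z" for z
    using assms by (cases "z \<in> ball 0 1") (auto simp: hardy_fun_outside)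
  then show ?thesis
    using hardy_fun_inject by blast
qed

lemma norm_hardy_eqI:
  fixes f g :: hardy
  assumes "(\<lambda>n. (cmod (hardy_coeff f n))\<^sup>2) sums S"
  shows "(norm f)\<^sup>2 = S"
  unfolding hardy_norm_power2 using assms by (rule sums_unique[symmetric])

text \<open>The reproducing kernel of H^2 at \<open>p\<close>. For \<open>p\<close> outside the disk
  the coefficients are not square summable and the value is unspecified.\<close>

definition szego_kernel :: "complex \<Rightarrow> hardy" where
  "szego_kernel p = hardy_of_coeff (\<lambda>n. cnj p ^ n)"

lemma hardy_coeff_kernel:
  assumes "p \<in> ball 0 1"
  shows "hardy_coeff (szego_kernel p) n = cnj p ^ n"
proof -
  have "summable (\<lambda>n. ((cmod p)\<^sup>2) ^ n)"
    using assms by (intro summable_geometric) (simp add: abs_square_less_1)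
  then have "l2 (\<lambda>n. cnj p ^ n)"
    by (simp add: l2_def norm_power power_mult[symmetric] mult.commute)
  then show ?thesis
    by (simp add: szego_kernel_def hardy_coeff_of_coeff)
qed

lemma cinner_kernel:
  assumes "p \<in> ball 0 1"
  shows "cinner f (szego_kernel p) = hardy_fun f p"
  using sums_unique[OF hardy_fun_sums[OF assms, of f]]
  by (simp add: cinner_hardy_def hardy_coeff_kernel[OF assms])

lemma hardy_fun_kernel:
  assumes "p \<in> ball 0 1" "z \<in> ball 0 1"
  shows "hardy_fun (szego_kernel p) z = 1 / (1 - cnj p * z)"
proof -
  have "cmod (cnj p * z) < 1"
    using assms mult_strict_mono'[of "cmod p" 1 "cmod z" 1] by (simp add: norm_mult)
  from geometric_sums[OF this] show ?thesis
    using sums_unique2[OF hardy_fun_sums[OF assms(2), of "szego_kernel p"]]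
    by (simp add: hardy_coeff_kernel[OF assms(1)] power_mult_distrib)
qed

text \<open>Point evaluations are inner products with kernels, so an operator is determined by the
  action of its adjoint on kernels.\<close>

lemma hardy_kernel_eqI:
  assumes "\<And>p. p \<in> ball 0 1 \<Longrightarrow> cinner f (szego_kernel p) = cinner g (szego_kernel p)"
  shows "f = g"
  using assms by (intro hardy_fun_eqI) (simp add: cinner_kernel)

section \<open>Multiplication and division by linear polynomials\<close>

definition hardy_shift :: "hardy \<Rightarrow> hardy" where
  "hardy_shift f = hardy_of_coeff (case_nat 0 (hardy_coeff f))"

lemma hardy_coeff_shift: "hardy_coeff (hardy_shift f) = case_nat 0 (hardy_coeff f)"
proof -
  have "summable (\<lambda>n. (cmod (case_nat 0 (hardy_coeff f) (Suc n)))\<^sup>2)"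
    by (simp add: hardy_norm_summable)
  then have "l2 (case_nat 0 (hardy_coeff f))"
    unfolding l2_def by (subst (asm) summable_Suc_iff)
  then show ?thesis
    by (simp add: hardy_shift_def hardy_coeff_of_coeff)
qed

lemma hardy_fun_shift:
  assumes "z \<in> ball 0 1"
  shows "hardy_fun (hardy_shift f) z = z * hardy_fun f z"
proof -
  have "(\<lambda>n. hardy_coeff (hardy_shift f) (Suc n) * z ^ Suc n) sums (z * hardy_fun f z)"
    using sums_mult[OF hardy_fun_sums[OF assms, of f], of z]
    by (simp add: hardy_coeff_shift mult_ac)
  then have "(\<lambda>n. hardy_coeff (hardy_shift f) n * z ^ n) sums (z * hardy_fun f z)"
    by (subst (asm) sums_Suc_iff) (simp add: hardy_coeff_shift)
  then show ?thesis
    using hardy_fun_sums[OF assms] sums_unique2 by blast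
qed

lemma norm_hardy_shift: "norm (hardy_shift f) = norm f"
proof -
  have "(\<lambda>n. (cmod (hardy_coeff (hardy_shift f) (Suc n)))\<^sup>2) sums (norm f)\<^sup>2"
    unfolding hardy_norm_power2 hardy_coeff_shift
    by (simp add: hardy_norm_summable summable_sums)
  then have "(\<lambda>n. (cmod (hardy_coeff (hardy_shift f) n))\<^sup>2) sums (norm f)\<^sup>2"
    by (subst (asm) sums_Suc_iff) (simp add: hardy_coeff_shift)
  from norm_hardy_eqI[OF this] show ?thesis
    by (simp add: power2_eq_iff_nonneg)
qed

text \<open>The analytic Toeplitz operator with symbol \<open>a * z + b\<close>. Linear symbols
  suffice because a linear-fractional function is a quotient of two of them.\<close>

definition mult_linear :: "complex \<Rightarrow> complex \<Rightarrow> hardy \<Rightarrow> hardy" where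
  "mult_linear a b f = b *\<^sub>C f + a *\<^sub>C hardy_shift f"

lemma hardy_fun_mult_linear:
  "z \<in> ball 0 1 \<Longrightarrow> hardy_fun (mult_linear a b f) z = (a * z + b) * hardy_fun f z"
  by (simp add: mult_linear_def hardy_fun_simps hardy_fun_shift algebra_simps)

lemma bounded_clinear_mult_linear: "bounded_clinear (mult_linear a b)"
proof (rule bounded_clinearI)
  show "mult_linear a b (x + y) = mult_linear a b x + mult_linear a b y"
    and "mult_linear a b (c *\<^sub>C x) = c *\<^sub>C mult_linear a b x" for x y c
    by (rule hardy_fun_eqI; simp add: hardy_fun_mult_linear hardy_fun_simps algebra_simps)+
  show "norm (mult_linear a b x) \<le> (cmod b + cmod a) * norm x" for x
    unfolding mult_linear_def
    by (rule order_trans[OF norm_triangle_ineq]) (simp add: norm_scaleC norm_hardy_shift algebra_simps)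
qed

text \<open>The shift is isometric, so the norms involve only \<open>a * cnj b\<close>, \<open>c * cnj d\<close> and the moduli of the
  coefficients; testing the hypothesis at one well-chosen point of the circle is enough.\<close>

lemma norm_mult_linear_mono:
  assumes "\<And>z. cmod z = 1 \<Longrightarrow> cmod (a * z + b) \<le> cmod (c * z + d)"
  shows "norm (mult_linear a b f) \<le> norm (mult_linear c d f)"
proof -
  \<comment> \<open>On the circle \<open>|c z + d|^2 - |a z + b|^2\<close> equals
    \<open>D - 2 Re (e * cnj z)\<close>. The difference of the squared norms has the same shape,
    \<open>D |f|^2 - 2 Re (e * s)\<close>, with \<open>|s| \<le> |f|^2\<close>. So
    \<open>2 |e| \<le> D\<close> suffices, and \<open>z = sgn e\<close> yields it.\<close>
  define e where "e = b * cnj a - d * cnj c"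
  define D where "D = (cmod c)\<^sup>2 + (cmod d)\<^sup>2 - (cmod a)\<^sup>2 - (cmod b)\<^sup>2"
  have circ: "2 * Re (e * cnj z) \<le> D" if "cmod z = 1" for z
  proof -
    have q: "(cmod (x * z + y))\<^sup>2 = (cmod x)\<^sup>2 + (cmod y)\<^sup>2 + 2 * Re (y * cnj x * cnj z)" for x y
    proof -
      have "(cmod (u + y))\<^sup>2 = (cmod u)\<^sup>2 + (cmod y)\<^sup>2 + 2 * Re (y * cnj u)" for u
        unfolding cmod_power2 by (simp add: power2_eq_square algebra_simps)
      from this[of "x * z"] show ?thesis
        using that by (simp add: norm_mult mult.assoc)
    qed
    have "(cmod (a * z + b))\<^sup>2 \<le> (cmod (c * z + d))\<^sup>2"
      using assms[OF that] by (intro power_mono) auto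
    then show ?thesis
      unfolding q e_def D_def by (simp add: algebra_simps)
  qed
  have e: "2 * cmod e \<le> D"
  proof (cases "e = 0")
    case True
    then show ?thesis using circ[of 1] by simp
  next
    case False
    then have "e * cnj (sgn e) = cmod e"
      by (simp add: sgn_eq flip: complex_norm_square) (simp add: power2_eq_square)
    then show ?thesis using circ[of "sgn e"] False by (simp add: norm_sgn)
  qed
  define s where "s = cinner f (hardy_shift f)"
  have s: "cmod s \<le> (norm f)\<^sup>2"
    unfolding s_def using cinner_Cauchy_Schwarz[of f "hardy_shift f"]
    by (simp add: norm_hardy_shift power2_eq_square)
  have "2 * Re (e * s) \<le> 2 * (cmod e * (norm f)\<^sup>2)"
    using complex_Re_le_cmod[of "e * s"] mult_left_mono[OF s, of "cmod e"] by (simp add: norm_mult)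
  also have "\<dots> \<le> D * (norm f)\<^sup>2"
    using mult_right_mono[OF e, of "(norm f)\<^sup>2"] by simp
  finally have "(norm (mult_linear a b f))\<^sup>2 \<le> (norm (mult_linear c d f))\<^sup>2"
    unfolding mult_linear_def norm_add_scaleC_power2 norm_hardy_shift s_def[symmetric] e_def D_def
    by (simp add: algebra_simps)
  then show ?thesis
    by (rule power2_le_imp_le) simp
qed

text \<open>The recursion comes from comparing coefficients in
  \<open>(a z + b) g = f\<close>.\<close>

fun linear_quotient_coeff :: "complex \<Rightarrow> complex \<Rightarrow> (nat \<Rightarrow> complex) \<Rightarrow> nat \<Rightarrow> complex" where
  "linear_quotient_coeff a b f 0 = f 0 / b"
| "linear_quotient_coeff a b f (Suc n) = (f (Suc n) - a * linear_quotient_coeff a b f n) / b"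

definition div_linear :: "complex \<Rightarrow> complex \<Rightarrow> hardy \<Rightarrow> hardy" where
  "div_linear a b f = hardy_of_coeff (linear_quotient_coeff a b (hardy_coeff f))"

lemma L2_set_lessThan_Suc_shift:
  fixes f :: "nat \<Rightarrow> real"
  shows "L2_set f {..<Suc n} = sqrt ((f 0)\<^sup>2 + (L2_set (\<lambda>i. f (Suc i)) {..<n})\<^sup>2)"
  unfolding L2_set_def sum.lessThan_Suc_shift by (simp add: sum_nonneg)

text \<open>From \<open>b g = f - a z g\<close> the triangle inequality gives
  \<open>(|b| - |a|) |g| \<le> |f|\<close>. As \<open>g\<close> is not yet known to be square
  summable, the estimate is made for partial sums, where the shift can only lose terms.\<close>

lemma l2_linear_quotient_coeff:
  assumes f: "l2 f" and ab: "cmod a < cmod b"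
  shows "l2 (linear_quotient_coeff a b f)"
proof -
  define g where "g = linear_quotient_coeff a b f"
  define F where "F = norm (hardy_of_coeff f)"
  have F: "L2_set (\<lambda>n. cmod (f n)) {..<N} \<le> F" for N
    using hardy_norm_partial[of "hardy_of_coeff f" N] f by (simp add: F_def hardy_coeff_of_coeff)
  have b: "b \<noteq> 0" using ab by auto
  have g: "b * g n = f n + (case n of 0 \<Rightarrow> 0 | Suc m \<Rightarrow> - a * g m)" for n
    unfolding g_def using b by (cases n) auto
  have bound: "(cmod b - cmod a) * L2_set (\<lambda>n. cmod (g n)) {..<N} \<le> F" for N
  proof -
    define h where "h = (\<lambda>n. cmod (case n of 0 \<Rightarrow> 0 | Suc m \<Rightarrow> - a * g m))"
    have h: "L2_set h {..<N} \<le> cmod a * L2_set (\<lambda>n. cmod (g n)) {..<N}"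
    proof (cases N)
      case (Suc M)
      have "L2_set h {..<N} = L2_set (\<lambda>n. cmod a * cmod (g n)) {..<M}"
        unfolding Suc L2_set_lessThan_Suc_shift by (simp add: h_def norm_mult)
      also have "\<dots> = cmod a * L2_set (\<lambda>n. cmod (g n)) {..<M}"
        by (simp add: L2_set_right_distrib)
      also have "\<dots> \<le> cmod a * L2_set (\<lambda>n. cmod (g n)) {..<N}"
        unfolding Suc L2_set_def by (intro mult_left_mono real_sqrt_le_mono sum_mono2) auto
      finally show ?thesis .
    qed simp
    have "cmod b * L2_set (\<lambda>n. cmod (g n)) {..<N} = L2_set (\<lambda>n. cmod (b * g n)) {..<N}"
      by (simp add: L2_set_right_distrib norm_mult)
    also have "\<dots> \<le> L2_set (\<lambda>n. cmod (f n) + h n) {..<N}"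
      unfolding g h_def by (intro L2_set_mono norm_triangle_ineq) auto
    also have "\<dots> \<le> L2_set (\<lambda>n. cmod (f n)) {..<N} + L2_set h {..<N}"
      by (rule L2_set_triangle_ineq)
    finally show ?thesis
      using h F[of N] by (simp add: algebra_simps)
  qed
  define K where "K = F / (cmod b - cmod a)"
  have K: "L2_set (\<lambda>n. cmod (g n)) {..<N} \<le> K" for N
    unfolding K_def using bound[of N] ab by (simp add: field_simps)
  have "(\<Sum>n\<le>N. (cmod (g n))\<^sup>2) \<le> K\<^sup>2" for N
    using K[of "Suc N"] unfolding L2_set_def lessThan_Suc_atMost by (intro sqrt_le_D)
  then show ?thesis
    unfolding l2_def g_def[symmetric] by (intro bounded_imp_summable) auto
qed

lemma mult_div_linear:
  assumes ab: "cmod a < cmod b"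
  shows "mult_linear a b (div_linear a b f) = f"
proof (rule hardy_coeff_eqI)
  fix n
  have "b \<noteq> 0" using ab by auto
  then show "hardy_coeff (mult_linear a b (div_linear a b f)) n = hardy_coeff f n"
    by (cases n) (simp_all add: mult_linear_def div_linear_def hardy_coeff_shift
        hardy_coeff_of_coeff l2_linear_quotient_coeff[OF l2_hardy_coeff ab])
qed

lemma linear_neq_0:
  assumes "cmod a < cmod b" "cmod z \<le> 1"
  shows "a * z + b \<noteq> 0"
proof
  assume "a * z + b = 0"
  then have "cmod b = cmod a * cmod z"
    by (metis add_eq_0_iff norm_minus_cancel norm_mult)
  also have "\<dots> \<le> cmod a" using assms by (simp add: mult_left_le)
  finally show False using assms by simp
qed

lemma hardy_fun_div_linear:
  assumes "cmod a < cmod b" "z \<in> ball 0 1"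
  shows "hardy_fun (div_linear a b f) z = hardy_fun f z / (a * z + b)"
  using hardy_fun_mult_linear[OF assms(2), of a b "div_linear a b f"]
    linear_neq_0[OF assms(1), of z] assms
  by (simp add: mult_div_linear field_simps)

lemma div_mult_linear:
  assumes "cmod a < cmod b"
  shows "div_linear a b (mult_linear a b f) = f"
  by (rule hardy_fun_eqI)
    (use linear_neq_0[OF assms] assms in \<open>simp add: hardy_fun_div_linear hardy_fun_mult_linear\<close>)

lemma bounded_clinear_div_linear:
  assumes ab: "cmod a < cmod b"
  shows "bounded_clinear (div_linear a b)"
proof (rule bounded_clinearI)
  show "div_linear a b (x + y) = div_linear a b x + div_linear a b y"
    and "div_linear a b (c *\<^sub>C x) = c *\<^sub>C div_linear a b x" for x y c
    by (rule hardy_fun_eqI; simp add: hardy_fun_div_linear[OF ab] hardy_fun_simps add_divide_distrib)+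
  fix x
  define y where "y = div_linear a b x"
  have "norm (b *\<^sub>C y) \<le> norm x + norm (a *\<^sub>C hardy_shift y)"
    using mult_div_linear[OF ab, of x] norm_triangle_ineq4[of x "a *\<^sub>C hardy_shift y"]
    unfolding y_def[symmetric] mult_linear_def by (metis add_diff_cancel_right')
  then have "(cmod b - cmod a) * norm y \<le> norm x"
    by (simp add: norm_scaleC norm_hardy_shift algebra_simps)
  then show "norm (div_linear a b x) \<le> 1 / (cmod b - cmod a) * norm x"
    using ab unfolding y_def[symmetric] by (simp add: field_simps)
qed

section \<open>The monomial basis and existence of adjoints\<close>

definition hardy_monom :: "nat \<Rightarrow> hardy" where
  "hardy_monom n = hardy_of_coeff (\<lambda>k. if k = n then 1 else 0)"

lemma hardy_coeff_monom: "hardy_coeff (hardy_monom n) k = (if k = n then 1 else 0)"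
proof -
  have "summable (\<lambda>k. (cmod (if k = n then 1 else 0))\<^sup>2)"
    by (rule summable_finite[of "{n}"]) auto
  then have "l2 (\<lambda>k. if k = n then 1 else 0)"
    by (simp add: l2_def)
  then show ?thesis
    by (simp add: hardy_monom_def hardy_coeff_of_coeff)
qed

lemma hardy_coeff_sum: "hardy_coeff (\<Sum>i\<in>I. g i) k = (\<Sum>i\<in>I. hardy_coeff (g i) k)"
  by (induction I rule: infinite_finite_induct) auto

lemma hardy_coeff_sum_monom:
  "hardy_coeff (\<Sum>n<N. c n *\<^sub>C hardy_monom n) k = (if k < N then c k else 0)"
  by (simp add: hardy_coeff_sum hardy_coeff_monom if_distrib cong: if_cong)

text \<open>By orthonormality the squared norm of the remainder is the tail of the convergent series
  for \<open>|f|^2\<close>.\<close>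

lemma hardy_monom_sums: "(\<lambda>n. hardy_coeff f n *\<^sub>C hardy_monom n) sums f"
proof -
  define g where "g N = (\<Sum>n<N. hardy_coeff f n *\<^sub>C hardy_monom n)" for N
  have "(norm (f - g N))\<^sup>2 = (norm f)\<^sup>2 - (\<Sum>n<N. (cmod (hardy_coeff f n))\<^sup>2)" for N
  proof (rule norm_hardy_eqI)
    have "(\<lambda>n. if n < N then (cmod (hardy_coeff f n))\<^sup>2 else 0) sums
        (\<Sum>n<N. (cmod (hardy_coeff f n))\<^sup>2)"
      using sums_If_finite_set[of "{..<N}" "\<lambda>n. (cmod (hardy_coeff f n))\<^sup>2"] by simp
    from sums_diff[OF summable_sums[OF hardy_norm_summable[of f]] this]
    have "(\<lambda>n. (cmod (hardy_coeff f n))\<^sup>2 - (if n < N then (cmod (hardy_coeff f n))\<^sup>2 else 0)) sums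
       ((norm f)\<^sup>2 - (\<Sum>n<N. (cmod (hardy_coeff f n))\<^sup>2))"
      by (simp add: hardy_norm_power2)
    then show "(\<lambda>n. (cmod (hardy_coeff (f - g N) n))\<^sup>2) sums
       ((norm f)\<^sup>2 - (\<Sum>n<N. (cmod (hardy_coeff f n))\<^sup>2))"
      by (rule sums_cong[THEN iffD1, rotated]) (simp add: g_def hardy_coeff_sum_monom)
  qed
  moreover have "(\<lambda>N. (norm f)\<^sup>2 - (\<Sum>n<N. (cmod (hardy_coeff f n))\<^sup>2)) \<longlonglongrightarrow> (norm f)\<^sup>2 - (norm f)\<^sup>2"
    using summable_LIMSEQ[OF hardy_norm_summable[of f]]
    unfolding hardy_norm_power2[symmetric] by (intro tendsto_intros)
  ultimately have "(\<lambda>N. (norm (f - g N))\<^sup>2) \<longlonglongrightarrow> 0"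
    by simp
  then have "(\<lambda>N. sqrt ((norm (f - g N))\<^sup>2)) \<longlonglongrightarrow> sqrt 0"
    by (rule tendsto_real_sqrt)
  then have "(\<lambda>N. norm (g N - f)) \<longlonglongrightarrow> 0"
    by (simp add: norm_minus_commute)
  then have "g \<longlonglongrightarrow> f"
    by (simp only: tendsto_norm_zero_iff LIM_zero_iff)
  then show ?thesis
    unfolding sums_def g_def .
qed

lemma bounded_linear_cinner_left: "bounded_linear (\<lambda>x. cinner x (y::'a::complex_hilbert))"
  by (rule bounded_linear_intro[where K = "norm y"])
    (simp_all add: cinner_add_left scaleR_scaleC[where ?'a = 'a] cinner_scaleC_left
      cinner_Cauchy_Schwarz scaleR_conv_of_real)

text \<open>Riesz representation in coordinates: the \<open>n\<close>-th coefficient of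
  \<open>B y\<close> has to be \<open>cnj <A z^n, y>\<close>, and the content is that this sequence
  is square summable.\<close>

lemma hardy_adjoint_exists:
  fixes A :: "hardy \<Rightarrow> hardy"
  assumes A: "bounded_clinear A"
  obtains B where "adjoint_pair A B"
proof -
  obtain K where K: "K \<ge> 0" "\<And>x. norm (A x) \<le> K * norm x"
    using bounded_clinear_bound[OF A] by metis
  have lin: "bounded_linear (\<lambda>x. cinner (A x) y)" for y
    using bounded_linear_compose[OF bounded_linear_cinner_left bounded_clinear_bounded_linear[OF A]] .
  have mon: "cinner (A (c *\<^sub>C hardy_monom n)) y = c * cinner (A (hardy_monom n)) y" for c n y
    by (simp add: bounded_clinear_scaleC[OF A] cinner_scaleC_left)
  have "\<exists>w. \<forall>x. cinner (A x) y = cinner x w" for y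
  proof -
    define b where "b n = cnj (cinner (A (hardy_monom n)) y)" for n
    have L: "L2_set (\<lambda>n. cmod (b n)) {..<N} \<le> K * norm y" for N
    proof -
      \<comment> \<open>Testing the functional on the truncation of \<open>b\<close> itself gives
        \<open>L^2 \<le> K L |y|\<close>, hence a bound for \<open>L\<close> uniform in
        \<open>N\<close>.\<close>
      define x where "x = (\<Sum>n<N. b n *\<^sub>C hardy_monom n)"
      define L where "L = L2_set (\<lambda>n. cmod (b n)) {..<N}"
      have L0: "L \<ge> 0" by (simp add: L_def)
      have L2: "L\<^sup>2 = (\<Sum>n<N. (cmod (b n))\<^sup>2)"
        by (simp add: L_def L2_set_def sum_nonneg)
      have "(\<lambda>n. (cmod (hardy_coeff x n))\<^sup>2) sums (\<Sum>n<N. (cmod (b n))\<^sup>2)"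
        using sums_If_finite_set[of "{..<N}" "\<lambda>n. (cmod (b n))\<^sup>2"]
        by (rule sums_cong[THEN iffD1, rotated]) (simp_all add: x_def hardy_coeff_sum_monom)
      then have nx: "(norm x)\<^sup>2 = L\<^sup>2"
        unfolding L2 by (rule norm_hardy_eqI)
      have "cinner (A x) y = of_real (L\<^sup>2)"
        unfolding x_def linear_sum[OF bounded_linear.linear[OF lin]] mon L2 of_real_sum
          complex_norm_square by (simp add: b_def)
      then have "L\<^sup>2 = cmod (cinner (A x) y)"
        by (simp add: norm_power)
      also have "\<dots> \<le> norm (A x) * norm y"
        by (rule cinner_Cauchy_Schwarz)
      also have "\<dots> \<le> (K * norm x) * norm y"
        by (intro mult_right_mono K) simp
      also have "norm x = L"
        using nx L0 by (simp add: power2_eq_iff_nonneg)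
      finally have "L * L \<le> L * (K * norm y)"
        by (simp add: power2_eq_square mult_ac)
      then show ?thesis
        unfolding L_def[symmetric] using K L0 by (cases "L = 0") (auto simp: mult_le_cancel_left)
    qed
    have "(\<Sum>n\<le>N. (cmod (b n))\<^sup>2) \<le> (K * norm y)\<^sup>2" for N
      using L[of "Suc N"] unfolding L2_set_def lessThan_Suc_atMost by (intro sqrt_le_D)
    then have b: "l2 b"
      unfolding l2_def by (intro bounded_imp_summable) auto
    have "cinner (A x) y = cinner x (hardy_of_coeff b)" for x
    proof -
      have "(\<lambda>n. hardy_coeff x n * cnj (b n)) sums cinner (A x) y"
        using bounded_linear.sums[OF lin hardy_monom_sums] unfolding mon by (simp add: b_def)
      then show ?thesis
        unfolding cinner_hardy_def[of x] hardy_coeff_of_coeff[OF b] by (rule sums_unique)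
    qed
    then show ?thesis by blast
  qed
  then have "\<exists>B. \<forall>y x. cinner (A x) y = cinner x (B y)"
    by metis
  then show thesis
    using that unfolding adjoint_pair_def by blast
qed

section \<open>Boundedness of composition operators with linear-fractional symbols\<close>

definition mult_fraction :: "complex \<Rightarrow> complex \<Rightarrow> complex \<Rightarrow> complex \<Rightarrow> hardy \<Rightarrow> hardy" where
  "mult_fraction a b c d = mult_linear a b \<circ> div_linear c d"

lemma hardy_fun_mult_fraction:
  assumes "cmod c < cmod d" "z \<in> ball 0 1"
  shows "hardy_fun (mult_fraction a b c d f) z = (a * z + b) / (c * z + d) * hardy_fun f z"
  using assms by (simp add: mult_fraction_def hardy_fun_mult_linear hardy_fun_div_linear)

lemma bounded_clinear_mult_fraction:
  "cmod c < cmod d \<Longrightarrow> bounded_clinear (mult_fraction a b c d)"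
  unfolding mult_fraction_def
  by (intro bounded_clinear_comp bounded_clinear_mult_linear bounded_clinear_div_linear)

text \<open>With \<open>f = (c z + d) g\<close> the claim compares the products of one
  \<open>g\<close> with two linear polynomials, so \<open>norm_mult_linear_mono\<close> does the
  work of the maximum principle.\<close>

lemma norm_mult_fraction_le:
  assumes cd: "cmod c < cmod d" and "t \<ge> 0"
    and le: "\<And>z. cmod z = 1 \<Longrightarrow> cmod (a * z + b) \<le> t * cmod (c * z + d)"
  shows "norm (mult_fraction a b c d f) \<le> t * norm f"
proof -
  define g where "g = div_linear c d f"
  have "norm (mult_linear a b g) \<le> norm (mult_linear (of_real t * c) (of_real t * d) g)"
  proof (rule norm_mult_linear_mono)
    fix z :: complex assume "cmod z = 1"
    have "of_real t * c * z + of_real t * d = of_real t * (c * z + d)"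
      by (simp add: algebra_simps)
    then show "cmod (a * z + b) \<le> cmod (of_real t * c * z + of_real t * d)"
      using le[OF \<open>cmod z = 1\<close>] \<open>t \<ge> 0\<close> by (simp add: norm_mult)
  qed
  also have "mult_linear (of_real t * c) (of_real t * d) g = of_real t *\<^sub>C mult_linear c d g"
    by (rule hardy_fun_eqI) (simp add: hardy_fun_mult_linear hardy_fun_simps algebra_simps)
  also have "norm \<dots> = t * norm f"
    using \<open>t \<ge> 0\<close> by (simp add: norm_scaleC g_def mult_div_linear[OF cd])
  finally show ?thesis
    by (simp add: mult_fraction_def g_def)
qed

section \<open>Littlewood's subordination principle\<close>

lemma hardy_fun_mult_funpow:
  assumes "\<And>f. hardy_fun (M f) z = m * hardy_fun f z"
  shows "hardy_fun ((M ^^ n) f) z = m ^ n * hardy_fun f z"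
  by (induction n) (simp_all add: assms mult.assoc)

text \<open>Splitting off the term \<open>n = 0\<close> leaves a vector in the range of \<open>M\<close>, which is orthogonal to
  \<open>k\<close>: this is the induction behind Littlewood's subordination principle.\<close>

lemma norm_orbit_sum_le:
  fixes M :: "'a::complex_hilbert \<Rightarrow> 'a"
  assumes M: "bounded_clinear M" and contr: "\<And>x. norm (M x) \<le> norm x"
    and orth: "\<And>x. cinner (M x) k = 0"
  shows "(norm (\<Sum>n<N. a n *\<^sub>C (M ^^ n) k))\<^sup>2 \<le> (norm k)\<^sup>2 * (\<Sum>n<N. (cmod (a n))\<^sup>2)"
proof (induction N arbitrary: a)
  case (Suc N)
  define y where "y = (\<Sum>n<N. a (Suc n) *\<^sub>C (M ^^ n) k)"
  have lin: "linear M"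
    using bounded_linear.linear[OF bounded_clinear_bounded_linear[OF M]] .
  have "M y = (\<Sum>n<N. a (Suc n) *\<^sub>C (M ^^ Suc n) k)"
    unfolding y_def linear_sum[OF lin] by (simp add: bounded_clinear_scaleC[OF M])
  then have "(\<Sum>n<Suc N. a n *\<^sub>C (M ^^ n) k) = M y + a 0 *\<^sub>C k"
    unfolding sum.lessThan_Suc_shift by simp
  then have "(norm (\<Sum>n<Suc N. a n *\<^sub>C (M ^^ n) k))\<^sup>2 = (norm (M y))\<^sup>2 + (cmod (a 0))\<^sup>2 * (norm k)\<^sup>2"
    by (simp add: norm_add_power2 cinner_scaleC_right orth norm_scaleC power_mult_distrib)
  also have "\<dots> \<le> (norm y)\<^sup>2 + (cmod (a 0))\<^sup>2 * (norm k)\<^sup>2"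
    using contr by (simp add: power_mono)
  also have "(norm y)\<^sup>2 \<le> (norm k)\<^sup>2 * (\<Sum>n<N. (cmod (a (Suc n)))\<^sup>2)"
    unfolding y_def by (rule Suc.IH)
  finally show ?case
    unfolding sum.lessThan_Suc_shift by (simp add: algebra_simps)
qed simp

text \<open>The finite estimate, applied to coefficients set to zero below \<open>m\<close>, makes
  the partial sums Cauchy; the norm bound survives in the limit.\<close>

lemma orbit_sum_converges:
  fixes M :: "'a::complex_hilbert \<Rightarrow> 'a"
  assumes M: "bounded_clinear M" and contr: "\<And>x. norm (M x) \<le> norm x"
    and orth: "\<And>x. cinner (M x) k = 0" and a: "summable (\<lambda>n. (cmod (a n))\<^sup>2)"
  obtains g where "(\<lambda>n. a n *\<^sub>C (M ^^ n) k) sums g" "(norm g)\<^sup>2 \<le> (norm k)\<^sup>2 * (\<Sum>n. (cmod (a n))\<^sup>2)"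
proof -
  note bound = norm_orbit_sum_le[OF M contr orth]
  have tail: "(norm (\<Sum>n\<in>{m..<N}. a n *\<^sub>C (M ^^ n) k))\<^sup>2 \<le> (norm k)\<^sup>2 * (\<Sum>n\<in>{m..<N}. (cmod (a n))\<^sup>2)"
    for m N
  proof -
    define a' where "a' n = (if n < m then 0 else a n)" for n
    have z: "0 *\<^sub>C x = 0" for x :: 'a
      using scaleR_scaleC[of 0 x] by simp
    have "(\<Sum>n\<in>{m..<N}. a n *\<^sub>C (M ^^ n) k) = (\<Sum>n<N. a' n *\<^sub>C (M ^^ n) k)"
      by (rule sum.mono_neutral_cong_left) (auto simp: a'_def z)
    moreover have "(\<Sum>n\<in>{m..<N}. (cmod (a n))\<^sup>2) = (\<Sum>n<N. (cmod (a' n))\<^sup>2)"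
      by (rule sum.mono_neutral_cong_left) (auto simp: a'_def)
    ultimately show ?thesis
      using bound[of a' N] by simp
  qed
  have "summable (\<lambda>n. a n *\<^sub>C (M ^^ n) k)"
    unfolding summable_Cauchy
  proof (intro allI impI)
    fix e :: real assume e: "e > 0"
    \<comment> \<open>The summand 1 keeps the denominator positive also for
      \<open>k = 0\<close>.\<close>
    define d where "d = e\<^sup>2 / ((norm k)\<^sup>2 + 1)"
    have "d > 0" unfolding d_def using e by (simp add: add_nonneg_pos)
    then obtain N where N: "\<And>m n. m \<ge> N \<Longrightarrow> norm (\<Sum>i\<in>{m..<n}. (cmod (a i))\<^sup>2) < d"
      using a unfolding summable_Cauchy by metis
    have "norm (\<Sum>i\<in>{m..<n}. a i *\<^sub>C (M ^^ i) k) < e" if "m \<ge> N" for m n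
    proof -
      have "(norm (\<Sum>i\<in>{m..<n}. a i *\<^sub>C (M ^^ i) k))\<^sup>2 \<le> (norm k)\<^sup>2 * (\<Sum>i\<in>{m..<n}. (cmod (a i))\<^sup>2)"
        by (rule tail)
      also have "\<dots> \<le> (norm k)\<^sup>2 * d"
        using N[OF that, of n] by (intro mult_left_mono) auto
      also have "\<dots> < ((norm k)\<^sup>2 + 1) * d"
        using \<open>d > 0\<close> by simp
      also have "\<dots> = e\<^sup>2"
        unfolding d_def using add_nonneg_pos[of "(norm k)\<^sup>2" 1] by simp
      finally show ?thesis
        by (rule power2_less_imp_less) (use e in simp)
    qed
    then show "\<exists>N. \<forall>m\<ge>N. \<forall>n. norm (\<Sum>i\<in>{m..<n}. a i *\<^sub>C (M ^^ i) k) < e"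
      by blast
  qed
  then obtain g where g: "(\<lambda>n. a n *\<^sub>C (M ^^ n) k) sums g"
    by (auto simp: summable_def)
  have "(norm g)\<^sup>2 \<le> (norm k)\<^sup>2 * (\<Sum>n. (cmod (a n))\<^sup>2)"
  proof (rule LIMSEQ_le)
    show "(\<lambda>N. (norm (\<Sum>n<N. a n *\<^sub>C (M ^^ n) k))\<^sup>2) \<longlonglongrightarrow> (norm g)\<^sup>2"
      using g unfolding sums_def by (intro tendsto_intros)
    show "(\<lambda>N. (norm k)\<^sup>2 * (\<Sum>n<N. (cmod (a n))\<^sup>2)) \<longlonglongrightarrow> (norm k)\<^sup>2 * (\<Sum>n. (cmod (a n))\<^sup>2)"
      by (intro tendsto_intros summable_LIMSEQ a)
  qed (use bound in blast)
  then show thesis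
    using g that by blast
qed

text \<open>The functions \<open>szego_kernel p * \<phi>\<^sup>n\<close>, with \<open>\<phi> p = 0\<close>, are the orbit of the kernel under
  multiplication by \<open>\<phi>\<close>. Hence \<open>f \<mapsto> szego_kernel p * f \<circ> \<phi>\<close> is bounded, and dividing by the kernel
  is multiplication by a polynomial.\<close>

lemma
  assumes cd: "cmod c < cmod d"
    and le: "\<And>z. cmod z = 1 \<Longrightarrow> cmod (a * z + b) \<le> cmod (c * z + d)"
    and p: "p \<in> ball 0 1" "a * p + b = 0"
    and \<phi>: "\<And>z. z \<in> ball 0 1 \<Longrightarrow> \<phi> z \<in> ball 0 1"
      "\<And>z. z \<in> ball 0 1 \<Longrightarrow> \<phi> z = (a * z + b) / (c * z + d)"
  shows hardy_fun_composition_fraction: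
      "\<And>f z. z \<in> ball 0 1 \<Longrightarrow> hardy_fun (composition_operator \<phi> f) z = hardy_fun f (\<phi> z)"
    and bounded_clinear_composition_fraction: "bounded_clinear (composition_operator \<phi>)"
proof -
  define M where "M = mult_fraction a b c d"
  have M: "bounded_clinear M"
    unfolding M_def using cd by (rule bounded_clinear_mult_fraction)
  have Mf: "hardy_fun (M f) z = \<phi> z * hardy_fun f z" if "z \<in> ball 0 1" for f z
    using hardy_fun_mult_fraction[OF cd that] \<phi>(2)[OF that] by (simp add: M_def)
  have contr: "norm (M f) \<le> norm f" for f
    using norm_mult_fraction_le[OF cd, of 1 a b f] le by (simp add: M_def)
  have orth: "cinner (M f) (szego_kernel p) = 0" for f
    using p by (simp add: cinner_kernel Mf \<phi>(2))
  obtain K where K: "K \<ge> 0" "\<And>f. norm (mult_linear (- cnj p) 1 f) \<le> K * norm f"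
    using bounded_clinear_bound[OF bounded_clinear_mult_linear] by metis
  have ex: "\<exists>g. (\<forall>z\<in>ball 0 1. hardy_fun g z = hardy_fun f (\<phi> z)) \<and>
      norm g \<le> (K * norm (szego_kernel p)) * norm f" for f
  proof -
    obtain g where g: "(\<lambda>n. hardy_coeff f n *\<^sub>C (M ^^ n) (szego_kernel p)) sums g"
      "(norm g)\<^sup>2 \<le> (norm (szego_kernel p))\<^sup>2 * (norm f)\<^sup>2"
      using orbit_sum_converges[OF M contr orth hardy_norm_summable[of f]]
      unfolding hardy_norm_power2 by blast
    have "hardy_fun (mult_linear (- cnj p) 1 g) z = hardy_fun f (\<phi> z)" if z: "z \<in> ball 0 1" for z
    proof -
      have "cmod (- cnj p) < cmod 1" using p by simp
      from linear_neq_0[OF this, of z] have nz: "1 - cnj p * z \<noteq> 0"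
        using z by simp
      \<comment> \<open>The series may be evaluated termwise, because evaluation at \<open>z\<close>
        is the bounded functional given by the kernel at \<open>z\<close>.\<close>
      have "(\<lambda>n. cinner (hardy_coeff f n *\<^sub>C (M ^^ n) (szego_kernel p)) (szego_kernel z)) sums cinner g (szego_kernel z)"
        by (rule bounded_linear.sums[OF bounded_linear_cinner_left g(1)])
      then have "(\<lambda>n. hardy_coeff f n * \<phi> z ^ n * hardy_fun (szego_kernel p) z) sums hardy_fun g z"
        by (simp add: cinner_kernel[OF z] hardy_fun_simps hardy_fun_mult_funpow[OF Mf[OF z]] mult.assoc)
      moreover have "(\<lambda>n. hardy_coeff f n * \<phi> z ^ n * hardy_fun (szego_kernel p) z)
          sums (hardy_fun f (\<phi> z) * hardy_fun (szego_kernel p) z)"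
        by (intro sums_mult2 hardy_fun_sums \<phi> z)
      ultimately have "hardy_fun g z = hardy_fun f (\<phi> z) * hardy_fun (szego_kernel p) z"
        by (rule sums_unique2)
      then show ?thesis
        using z p nz by (simp add: hardy_fun_mult_linear hardy_fun_kernel field_simps)
    qed
    moreover have "norm (mult_linear (- cnj p) 1 g) \<le> (K * norm (szego_kernel p)) * norm f"
    proof -
      have "norm g \<le> norm (szego_kernel p) * norm f"
        by (rule power2_le_imp_le) (use g(2) in \<open>simp_all add: power_mult_distrib\<close>)
      then have "K * norm g \<le> K * (norm (szego_kernel p) * norm f)"
        using K(1) by (rule mult_left_mono)
      then show ?thesis
        using K(2)[of g] by (simp add: mult.assoc)
    qed
    ultimately show ?thesis by blast
  qed
  \<comment> \<open>\<open>Abs_hardy\<close> is meaningful only once the composite is known to be a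
    Hardy function; \<open>g\<close> provides that.\<close>
  have eq: "composition_operator \<phi> f = g" if "\<forall>z\<in>ball 0 1. hardy_fun g z = hardy_fun f (\<phi> z)" for f g
  proof -
    have "(\<lambda>z. if z \<in> ball 0 1 then hardy_fun f (\<phi> z) else 0) = hardy_fun g"
      using that hardy_fun_outside by (intro ext) (metis (no_types))
    then show ?thesis
      unfolding composition_operator_def by (simp only: hardy_fun_inverse)
  qed
  show C: "hardy_fun (composition_operator \<phi> f) z = hardy_fun f (\<phi> z)" if "z \<in> ball 0 1" for f z
    using ex[of f] eq that by blast
  show "bounded_clinear (composition_operator \<phi>)"
  proof (rule bounded_clinearI)
    show "composition_operator \<phi> (f + g) = composition_operator \<phi> f + composition_operator \<phi> g"
      and "composition_operator \<phi> (c *\<^sub>C f) = c *\<^sub>C composition_operator \<phi> f" for f g c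
      by (rule hardy_fun_eqI; simp add: C hardy_fun_simps)+
    show "norm (composition_operator \<phi> f) \<le> (K * norm (szego_kernel p)) * norm f" for f
      using ex[of f] eq by metis
  qed
qed

section \<open>Parabolic selfmaps of the disk\<close>

text \<open>With \<open>v = 1 - cnj w * z\<close> this map is \<open>v \<mapsto> v / (1 + \<tau> v)\<close>, which is translation by \<open>\<tau>\<close> in the
  coordinate \<open>1 / v\<close>; the disk corresponds to the half-plane \<open>Re (1 / v) > 1 / 2\<close>.\<close>

definition parabolic_map :: "complex \<Rightarrow> complex \<Rightarrow> complex \<Rightarrow> complex" where
  "parabolic_map w \<tau> z = ((1 - \<tau>) * z + w * \<tau>) / (- \<tau> * cnj w * z + (1 + \<tau>))"

context
  fixes w :: complex
  assumes w: "cmod w = 1"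
begin

section \<open>Modulus estimates for numerator and denominator\<close>

lemma w_cnj: "w * cnj w = 1"
  using w by (simp add: complex_norm_square[symmetric])

lemma w_cnj': "w * (cnj w * x) = x" "cnj w * (w * x) = x"
  using w_cnj by (metis mult.assoc mult.commute mult_1)+

lemma parabolic_den: "- \<tau> * cnj w * z + (1 + \<tau>) = 1 + \<tau> * (1 - cnj w * z)"
  by (simp add: algebra_simps)

text \<open>The source of the translation form: dividing by the denominator shows that
  \<open>v = 1 - cnj w * z\<close> is sent to \<open>v / (1 + \<tau> * v)\<close>.\<close>

lemma parabolic_num: "cnj w * ((1 - \<tau>) * z + w * \<tau>) = (1 + \<tau> * (1 - cnj w * z)) - (1 - cnj w * z)"
  by (simp add: algebra_simps w_cnj w_cnj')

text \<open>Rotation by \<open>cnj w\<close> reduces this to \<open>w = 1\<close>. For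
  \<open>Re \<tau> \<ge> 0\<close> the right side is positive in the disk; for
  \<open>Re \<tau> < 0\<close> it becomes negative near the circle away from
  \<open>w\<close>.\<close>

lemma parabolic_modulus:
  "(cmod (- \<tau> * cnj w * z + (1 + \<tau>)))\<^sup>2 - (cmod ((1 - \<tau>) * z + w * \<tau>))\<^sup>2
    = 1 - (cmod z)\<^sup>2 + 2 * Re \<tau> * (cmod (1 - cnj w * z))\<^sup>2"
proof -
  have id: "(cmod (1 + \<tau> * (1 - u)))\<^sup>2 - (cmod ((1 + \<tau> * (1 - u)) - (1 - u)))\<^sup>2
      = 1 - (cmod u)\<^sup>2 + 2 * Re \<tau> * (cmod (1 - u))\<^sup>2" for u
    unfolding cmod_power2 by (simp add: power2_eq_square algebra_simps)
  have "cmod ((1 - \<tau>) * z + w * \<tau>) = cmod (cnj w * ((1 - \<tau>) * z + w * \<tau>))"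
    using w by (simp add: norm_mult)
  moreover have "cmod z = cmod (cnj w * z)"
    using w by (simp add: norm_mult)
  ultimately show ?thesis
    unfolding parabolic_num parabolic_den using id by simp
qed

text \<open>Such a \<open>\<tau>\<close> is closer to 0 than to -1, so the denominator has no zero
  on the closed disk.\<close>

lemma parabolic_den_coeff:
  assumes "Re \<tau> \<ge> 0"
  shows "cmod (- \<tau> * cnj w) < cmod (1 + \<tau>)"
proof -
  have "(cmod \<tau>)\<^sup>2 < (cmod (1 + \<tau>))\<^sup>2"
    using assms unfolding cmod_power2 by (simp add: power2_eq_square algebra_simps)
  then show ?thesis
    using w by (simp add: norm_mult power2_less_imp_less)
qed

text \<open>Such a \<open>\<tau>\<close> is closer to 0 than to 1. This places the zero of the
  numerator in the disk and makes the factor \<open>g\<close> of Cowen's formula invertible.\<close>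

lemma parabolic_num_coeff:
  assumes "Re \<tau> < 1 / 2"
  shows "cmod \<tau> < cmod (1 - \<tau>)"
proof -
  have "(cmod \<tau>)\<^sup>2 < (cmod (1 - \<tau>))\<^sup>2"
    using assms unfolding cmod_power2 by (simp add: power2_eq_square algebra_simps)
  then show ?thesis
    by (simp add: power2_less_imp_less)
qed

lemma parabolic_num_le_den:
  assumes "Re \<tau> \<ge> 0" "cmod z \<le> 1"
  shows "cmod ((1 - \<tau>) * z + w * \<tau>) \<le> cmod (- \<tau> * cnj w * z + (1 + \<tau>))"
proof -
  have "(cmod z)\<^sup>2 \<le> 1"
    using assms by (simp add: power_le_one)
  then have "1 - (cmod z)\<^sup>2 + 2 * Re \<tau> * (cmod (1 - cnj w * z))\<^sup>2 \<ge> 0"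
    using assms by simp
  then have "(cmod ((1 - \<tau>) * z + w * \<tau>))\<^sup>2 \<le> (cmod (- \<tau> * cnj w * z + (1 + \<tau>)))\<^sup>2"
    using parabolic_modulus[of \<tau> z] by linarith
  then show ?thesis
    by (rule power2_le_imp_le) simp
qed

lemma parabolic_den_neq_0:
  assumes "Re \<tau> \<ge> 0" "z \<in> ball 0 1"
  shows "1 + \<tau> * (1 - cnj w * z) \<noteq> 0"
  using linear_neq_0[OF parabolic_den_coeff[OF assms(1)], of z] assms(2)
  by (simp only: parabolic_den) simp

lemma parabolic_map_in_ball:
  assumes "Re \<tau> \<ge> 0" "z \<in> ball 0 1"
  shows "parabolic_map w \<tau> z \<in> ball 0 1"
proof -
  have "(cmod z)\<^sup>2 < 1"
    using assms by (simp add: abs_square_less_1)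
  then have "1 - (cmod z)\<^sup>2 + 2 * Re \<tau> * (cmod (1 - cnj w * z))\<^sup>2 > 0"
    using assms by (intro add_pos_nonneg) simp_all
  then have "(cmod ((1 - \<tau>) * z + w * \<tau>))\<^sup>2 < (cmod (- \<tau> * cnj w * z + (1 + \<tau>)))\<^sup>2"
    using parabolic_modulus[of \<tau> z] by linarith
  then have "cmod ((1 - \<tau>) * z + w * \<tau>) < cmod (- \<tau> * cnj w * z + (1 + \<tau>))"
    by (rule power2_less_imp_less) simp
  then show ?thesis
    unfolding parabolic_map_def mem_ball dist_0_norm norm_divide
    by (subst divide_less_eq_1) (metis norm_ge_zero order_le_less_trans)
qed

section \<open>Translations, automorphisms and zeros\<close>

lemma one_minus_cnj_parabolic_map:
  assumes "Re \<tau> \<ge> 0" "z \<in> ball 0 1"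
  shows "1 - cnj w * parabolic_map w \<tau> z = (1 - cnj w * z) / (1 + \<tau> * (1 - cnj w * z))"
proof -
  have "cnj w * parabolic_map w \<tau> z =
      ((1 + \<tau> * (1 - cnj w * z)) - (1 - cnj w * z)) / (1 + \<tau> * (1 - cnj w * z))"
    unfolding parabolic_map_def parabolic_den parabolic_num[symmetric] by simp
  then show ?thesis
    using parabolic_den_neq_0[OF assms] by (simp only: diff_divide_distrib divide_self) simp
qed

lemma eq_if_cnj_eq:
  assumes "1 - cnj w * x = 1 - cnj w * y"
  shows "x = y"
  using assms w by auto

lemma parabolic_map_comp:
  assumes "Re s \<ge> 0" "Re t \<ge> 0" and z: "z \<in> ball 0 1"
  shows "parabolic_map w s (parabolic_map w t z) = parabolic_map w (s + t) z"
proof (rule eq_if_cnj_eq)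
  define v where "v = 1 - cnj w * z"
  have n: "1 + t * v \<noteq> 0" "1 + (s + t) * v \<noteq> 0"
    using parabolic_den_neq_0[OF _ z, of t] parabolic_den_neq_0[OF _ z, of "s + t"] assms
    unfolding v_def by auto
  have "1 + s * (v / (1 + t * v)) = (1 + (s + t) * v) / (1 + t * v)"
    using n by (simp add: divide_simps) (simp add: algebra_simps)
  then show "1 - cnj w * parabolic_map w s (parabolic_map w t z)
      = 1 - cnj w * parabolic_map w (s + t) z"
    using n assms parabolic_map_in_ball[OF assms(2) z]
    by (simp add: one_minus_cnj_parabolic_map flip: v_def)
qed

lemma parabolic_map_0: "parabolic_map w 0 z = z"
  by (simp add: parabolic_map_def)

text \<open>A translation parallel to the boundary of the half-plane: its inverse, the translation
  by \<open>- \<tau>\<close>, is a selfmap too.\<close>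

lemma parabolic_map_automorphism:
  assumes "Re \<tau> = 0"
  shows "disk_automorphism (parabolic_map w \<tau>)"
  unfolding disk_automorphism_def
proof
  show "parabolic_map w \<tau> holomorphic_on ball 0 1"
    unfolding parabolic_map_def[abs_def] parabolic_den
    using assms parabolic_den_neq_0[of \<tau>] by (intro holomorphic_intros) auto
  show "bij_betw (parabolic_map w \<tau>) (ball 0 1) (ball 0 1)"
  proof (rule bij_betw_byWitness[where f' = "parabolic_map w (- \<tau>)"])
    show "parabolic_map w \<tau> ` ball 0 1 \<subseteq> ball 0 1"
      "parabolic_map w (- \<tau>) ` ball 0 1 \<subseteq> ball 0 1"
      using assms parabolic_map_in_ball by auto
  qed (use assms in \<open>simp_all add: parabolic_map_comp parabolic_map_0\<close>)
qed

text \<open>A zero has modulus \<open>|\<tau>| / |1 - \<tau>|\<close>, so it lies in the disk only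
  if \<open>\<tau>\<close> is closer to 0 than to 1.\<close>

lemma parabolic_map_zero:
  assumes "Re \<tau> \<ge> 0" "z \<in> ball 0 1" "parabolic_map w \<tau> z = 0"
  shows "Re \<tau> < 1 / 2"
proof -
  have "(1 - \<tau>) * z + w * \<tau> = 0"
    using assms(3) parabolic_den_neq_0[OF assms(1,2)] unfolding parabolic_map_def parabolic_den by simp
  then have e: "cmod \<tau> = cmod (1 - \<tau>) * cmod z"
    using w by (metis add_eq_0_iff norm_minus_cancel norm_mult mult_1)
  have "1 - \<tau> \<noteq> 0"
    using e by auto
  then have "cmod \<tau> < cmod (1 - \<tau>)"
    using assms(2) unfolding e by (simp add: mult_less_cancel_left2)
  then have "(cmod \<tau>)\<^sup>2 < (cmod (1 - \<tau>))\<^sup>2"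
    by (intro power_strict_mono) auto
  then show ?thesis
    unfolding cmod_power2 by (simp add: power2_eq_square algebra_simps)
qed

text \<open>A translation to the left pushes points near the boundary out of the half-plane; a point
  on the radius opposite to \<open>w\<close> shows it.\<close>

lemma parabolic_map_selfmap_Re:
  assumes den: "\<And>z. z \<in> ball 0 1 \<Longrightarrow> - \<tau> * cnj w * z + (1 + \<tau>) \<noteq> 0"
    and self: "parabolic_map w \<tau> ` ball 0 1 \<subseteq> ball 0 1"
  shows "Re \<tau> \<ge> 0"
proof (rule ccontr)
  define r where "r = - Re \<tau>"
  assume "\<not> ?thesis"
  then have r: "r > 0" by (simp add: r_def)
  \<comment> \<open>At \<open>z = - x w\<close> staying in the disk would need
    \<open>1 - x > 2 r (1 + x)\<close>, which fails once \<open>1 - x \<le> r\<close>. The maximum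
    with 0 covers \<open>r > 1\<close>.\<close>
  define x where "x = max 0 (1 - r)"
  have x: "0 \<le> x" "x < 1" "1 - x \<le> r" using r by (auto simp: x_def)
  define z where "z = - of_real x * w"
  have z: "cmod z = x" using x w by (simp add: z_def norm_mult)
  have v: "1 - cnj w * z = of_real (1 + x)"
    using w_cnj by (simp add: z_def mult_ac)
  have zb: "z \<in> ball 0 1" using z x by simp
  then have "parabolic_map w \<tau> z \<in> ball 0 1"
    using self by blast
  then have "cmod ((1 - \<tau>) * z + w * \<tau>) < cmod (- \<tau> * cnj w * z + (1 + \<tau>))"
    using den[OF zb] unfolding parabolic_map_def mem_ball dist_0_norm norm_divide
    by (subst (asm) divide_less_eq_1) auto
  then have "(cmod ((1 - \<tau>) * z + w * \<tau>))\<^sup>2 < (cmod (- \<tau> * cnj w * z + (1 + \<tau>)))\<^sup>2"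
    by (intro power_strict_mono) auto
  then have "1 - x\<^sup>2 - 2 * r * (1 + x)\<^sup>2 > 0"
    using parabolic_modulus[of \<tau> z] x unfolding v z norm_of_real r_def by simp
  then have "(1 + x) * (1 - x - 2 * r * (1 + x)) > 0"
    by (simp add: power2_eq_square algebra_simps)
  then have "1 - x - 2 * r * (1 + x) > 0"
    using x by (simp add: zero_less_mult_iff)
  moreover have "2 * r * (1 + x) \<ge> 2 * r"
    using r x by simp
  ultimately show False using x r by linarith
qed

section \<open>Composition operators with parabolic symbols and their adjoints\<close>

lemma
  assumes \<tau>: "Re \<tau> \<ge> 0" "Re \<tau> < 1 / 2"
  shows hardy_fun_composition_parabolic:
      "\<And>f z. z \<in> ball 0 1 \<Longrightarrow>
        hardy_fun (composition_operator (parabolic_map w \<tau>) f) z = hardy_fun f (parabolic_map w \<tau> z)"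
    and bounded_clinear_composition_parabolic:
      "bounded_clinear (composition_operator (parabolic_map w \<tau>))"
proof -
  \<comment> \<open>The subordination argument needs a zero of the symbol in the disk;
    \<open>Re \<tau> < 1 / 2\<close> provides this one.\<close>
  define p where "p = - w * \<tau> / (1 - \<tau>)"
  have n: "cmod \<tau> < cmod (1 - \<tau>)"
    using parabolic_num_coeff[OF \<tau>(2)] .
  then have n0: "1 - \<tau> \<noteq> 0" by auto
  have p: "p \<in> ball 0 1"
    using n w n0 by (simp add: p_def norm_divide norm_mult)
  have p0: "(1 - \<tau>) * p + w * \<tau> = 0"
    using n0 by (simp add: p_def)
  note * = parabolic_den_coeff[OF \<tau>(1)] parabolic_num_le_den[OF \<tau>(1) eq_refl] p p0
    parabolic_map_in_ball[OF \<tau>(1)] parabolic_map_def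
  show "hardy_fun (composition_operator (parabolic_map w \<tau>) f) z = hardy_fun f (parabolic_map w \<tau> z)"
    if "z \<in> ball 0 1" for f z
    by (rule hardy_fun_composition_fraction[OF *]) (use that in auto)
  show "bounded_clinear (composition_operator (parabolic_map w \<tau>))"
    by (rule bounded_clinear_composition_fraction[OF *]) auto
qed

text \<open>The bounds keep all three symbols in the range where the operators are known to act by
  composition; imaginary parameters of either sign are included.\<close>

lemma composition_parabolic_comp:
  assumes "Re s \<ge> 0" "Re s < 1 / 2" "Re t \<ge> 0" "Re t < 1 / 2" "Re (s + t) < 1 / 2"
  shows "composition_operator (parabolic_map w t) \<circ> composition_operator (parabolic_map w s) =
    composition_operator (parabolic_map w (s + t))"
proof
  fix f
  show "(composition_operator (parabolic_map w t) \<circ> composition_operator (parabolic_map w s)) f =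
      composition_operator (parabolic_map w (s + t)) f"
    by (rule hardy_fun_eqI)
      (use assms in \<open>simp add: hardy_fun_composition_parabolic parabolic_map_comp
        parabolic_map_in_ball[unfolded mem_ball_0]\<close>)
qed

text \<open>This is Cowen's formula for the adjoint, with the outer factor
  \<open>1 / (1 + cnj \<tau> * (1 - cnj w * z))\<close> moved to the right of the composition operator.\<close>

lemma adjoint_composition_parabolic:
  assumes \<tau>: "Re \<tau> \<ge> 0" "Re \<tau> < 1 / 2"
    and H: "adjoint_pair (mult_linear (- \<tau> * cnj w) (1 + \<tau>)) H"
  shows "adjoint_pair (composition_operator (parabolic_map w \<tau>))
    (composition_operator (parabolic_map w (cnj \<tau>)) \<circ> mult_linear (cnj \<tau> * cnj w) (1 - cnj \<tau>) \<circ> H)"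
proof -
  define s where "s = cnj \<tau>"
  have s: "Re s \<ge> 0" "Re s < 1 / 2" using \<tau> by (simp_all add: s_def)
  define X where "X = composition_operator (parabolic_map w s) \<circ> mult_linear (s * cnj w) (1 - s) \<circ> H"
  have "bounded_clinear H"
    using bounded_clinear_mult_linear H by (rule adjoint_pair_bounded_clinear)
  then have "bounded_clinear X"
    unfolding X_def
    by (intro bounded_clinear_comp bounded_clinear_mult_linear
        bounded_clinear_composition_parabolic[OF s])
  \<comment> \<open>The claim is approached from the other side: the adjoint \<open>Y\<close> of the
    candidate \<open>X\<close> is identified as the composition operator.\<close>
  then obtain Y where Y: "adjoint_pair X Y"
    by (rule hardy_adjoint_exists)
  \<comment> \<open>Kernels are eigenvectors of the adjoint of a multiplication operator, the
    eigenvalue being the conjugated value of the symbol.\<close>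
  have HK: "H (szego_kernel p) = cnj (1 + \<tau> * (1 - cnj w * p)) *\<^sub>C szego_kernel p" if p: "p \<in> ball 0 1" for p
    by (rule cinner_right_eqI)
      (simp add: adjoint_pairD[OF H, symmetric] cinner_kernel[OF p] hardy_fun_mult_linear[OF p]
        cinner_scaleC_right algebra_simps)
  \<comment> \<open>This action on kernels characterizes the adjoint of a composition
    operator.\<close>
  have XK: "X (szego_kernel p) = szego_kernel (parabolic_map w \<tau> p)" if p: "p \<in> ball 0 1" for p
  proof (rule hardy_fun_eqI)
    fix z :: complex assume z: "z \<in> ball 0 1"
    define y where "y = parabolic_map w s z"
    have y: "y \<in> ball 0 1"
      unfolding y_def using s(1) z by (rule parabolic_map_in_ball)
    define v where "v = 1 - cnj w * z"
    define h where "h = cnj (1 + \<tau> * (1 - cnj w * p))"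
    define q where "q = parabolic_map w \<tau> p"
    have q: "q \<in> ball 0 1"
      unfolding q_def using \<tau>(1) p by (rule parabolic_map_in_ball)
    have nv: "1 + s * v \<noteq> 0"
      unfolding v_def using parabolic_den_neq_0[OF s(1) z] .
    have nh: "h \<noteq> 0"
      unfolding h_def complex_cnj_zero_iff using parabolic_den_neq_0[OF \<tau>(1) p] .
    have "s * cnj w * y + (1 - s) = 1 - s * (1 - cnj w * y)"
      by (simp add: algebra_simps)
    also have "\<dots> = 1 - s * (v / (1 + s * v))"
      using one_minus_cnj_parabolic_map[OF s(1) z] by (simp add: y_def v_def)
    also have "\<dots> = 1 / (1 + s * v)"
      using nv by (simp add: field_simps)
    finally have G: "s * cnj w * y + (1 - s) = 1 / (1 + s * v)" .
    have y': "(1 + s * v) * y = (1 - s) * z + w * s"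
      using nv unfolding y_def parabolic_map_def parabolic_den v_def by simp
    have q': "h * cnj q = (1 - s) * cnj p + cnj w * s"
      using nh unfolding q_def parabolic_map_def parabolic_den h_def s_def by simp
    \<comment> \<open>Once the denominators of \<open>y\<close> and \<open>cnj q\<close> are
      cleared, both sides of \<open>e\<close> are the same polynomial in \<open>z\<close> and
      \<open>cnj p\<close>.\<close>
    have "(1 + s * v) * (1 - cnj p * y) = (1 + s * v) - cnj p * ((1 + s * v) * y)"
      by (simp add: algebra_simps)
    also have "\<dots> = h - (h * cnj q) * z"
      unfolding y' q' by (simp add: v_def h_def s_def algebra_simps)
    finally have e: "(1 + s * v) * (1 - cnj p * y) = h * (1 - cnj q * z)"
      by (simp add: algebra_simps)
    have "hardy_fun (X (szego_kernel p)) z = (1 / (1 + s * v)) * (h * (1 / (1 - cnj p * y)))"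
      unfolding X_def using s z y p
      by (simp add: hardy_fun_composition_parabolic HK hardy_fun_simps G h_def
          hardy_fun_mult_linear[OF y] hardy_fun_kernel[OF p y] flip: y_def)
    also have "\<dots> = h / ((1 + s * v) * (1 - cnj p * y))"
      by simp
    also have "\<dots> = 1 / (1 - cnj q * z)"
      unfolding e using nh by simp
    also have "\<dots> = hardy_fun (szego_kernel q) z"
      using q z by (simp add: hardy_fun_kernel)
    finally show "hardy_fun (X (szego_kernel p)) z = hardy_fun (szego_kernel (parabolic_map w \<tau> p)) z"
      by (simp add: q_def)
  qed
  have "Y = composition_operator (parabolic_map w \<tau>)"
  proof
    fix f
    show "Y f = composition_operator (parabolic_map w \<tau>) f"
      by (rule hardy_kernel_eqI)
        (simp only: adjoint_pairD[OF adjoint_pair_sym[OF Y]] XK cinner_kernel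
          parabolic_map_in_ball[OF \<tau>(1)] hardy_fun_composition_parabolic[OF \<tau>])
  qed
  then show ?thesis
    using adjoint_pair_sym[OF Y] unfolding X_def s_def by simp
qed

section \<open>Posinormality and coposinormality\<close>

lemma composition_parabolic_posinormal:
  assumes \<tau>: "Re \<tau> \<ge> 0" "Re \<tau> < 1 / 2"
  shows "posinormal (composition_operator (parabolic_map w \<tau>))"
    and "coposinormal (composition_operator (parabolic_map w \<tau>))"
proof -
  define C where "C t = composition_operator (parabolic_map w t)" for t
  define s where "s = cnj \<tau>"
  have s: "Re s \<ge> 0" "Re s < 1 / 2" using \<tau> by (simp_all add: s_def)
  have C: "bounded_clinear (C t)" if "Re t \<ge> 0" "Re t < 1 / 2" for t
    unfolding C_def using that by (rule bounded_clinear_composition_parabolic)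
  define h where "h = mult_linear (- \<tau> * cnj w) (1 + \<tau>)"
  define h' where "h' = div_linear (- \<tau> * cnj w) (1 + \<tau>)"
  define g where "g = mult_linear (s * cnj w) (1 - s)"
  define g' where "g' = div_linear (s * cnj w) (1 - s)"
  have hd: "cmod (- \<tau> * cnj w) < cmod (1 + \<tau>)"
    using parabolic_den_coeff[OF \<tau>(1)] .
  have gd: "cmod (s * cnj w) < cmod (1 - s)"
    using parabolic_num_coeff[OF s(2)] w by (simp add: norm_mult)
  have bounded: "bounded_clinear h" "bounded_clinear h'" "bounded_clinear g" "bounded_clinear g'"
    unfolding h_def h'_def g_def g'_def
    by (intro bounded_clinear_mult_linear bounded_clinear_div_linear hd gd)+
  obtain H where H: "adjoint_pair h H"
    using hardy_adjoint_exists[OF bounded(1)] .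
  obtain R where R: "adjoint_pair h' R"
    using hardy_adjoint_exists[OF bounded(2)] .
  note HR_bounded = adjoint_pair_bounded_clinear[OF bounded(1) H]
    adjoint_pair_bounded_clinear[OF bounded(2) R]
  have "h' \<circ> h = id"
    by (rule ext) (simp only: h_def h'_def o_apply id_apply div_mult_linear[OF hd])
  \<comment> \<open>Taking adjoints reverses the order, so a left inverse of \<open>h\<close> yields
    a right inverse of \<open>H\<close>.\<close>
  then have HR: "H \<circ> R = id"
    using adjoint_pair_unique[OF adjoint_pair_comp[OF R H], of id] by (simp add: adjoint_pair_def)
  have gg': "g \<circ> g' = id"
    by (rule ext) (simp only: g_def g'_def o_apply id_apply mult_div_linear[OF gd])
  have adj: "adjoint_pair (C \<tau>) (C s \<circ> g \<circ> H)"
    using adjoint_composition_parabolic[OF \<tau> H[unfolded h_def]] by (simp add: C_def g_def s_def)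
  \<comment> \<open>\<open>\<tau>\<close> and its conjugate \<open>s\<close> have the same real
    part, so the translation between them is imaginary and allowed in both directions.\<close>
  have "C s \<circ> C (\<tau> - s) = C \<tau>" "C \<tau> \<circ> C (s - \<tau>) = C s"
    unfolding C_def
    using composition_parabolic_comp[of "\<tau> - s" s] composition_parabolic_comp[of "s - \<tau>" \<tau>] \<tau>
    by (simp_all add: s_def)
  note comp = this
  have b: "bounded_clinear (C (\<tau> - s))" "bounded_clinear (C (s - \<tau>))"
    by (rule C; simp add: s_def)+
  \<comment> \<open>\<open>B\<close> solves \<open>C \<tau> = (C s g H) B\<close>: \<open>R\<close>
    and \<open>g'\<close> cancel \<open>H\<close> and \<open>g\<close>, and the imaginary
    translation turns \<open>C s\<close> into \<open>C \<tau>\<close>.\<close>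
  define B where "B = R \<circ> g' \<circ> C (\<tau> - s)"
  have B: "bounded_clinear B"
    unfolding B_def by (intro bounded_clinear_comp bounded HR_bounded b)
  obtain B' where B': "adjoint_pair B B'"
    using hardy_adjoint_exists[OF B] .
  have "C s \<circ> g \<circ> H \<circ> B = C s \<circ> (g \<circ> ((H \<circ> R) \<circ> g')) \<circ> C (\<tau> - s)"
    by (simp add: B_def o_assoc)
  also have "\<dots> = C \<tau>"
    by (simp add: HR gg' comp)
  finally show "posinormal (composition_operator (parabolic_map w \<tau>))"
    using posinormal_factor[OF C[OF \<tau>] B adj B'] by (simp add: C_def)
  \<comment> \<open>Now the adjoint is factored through \<open>C \<tau>\<close>, by rewriting
    \<open>C s\<close> as \<open>C \<tau> \<circ> C (s - \<tau>)\<close>.\<close>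
  define D where "D = C (s - \<tau>) \<circ> g \<circ> H"
  have D: "bounded_clinear D"
    unfolding D_def by (intro bounded_clinear_comp bounded HR_bounded b)
  obtain D' where D': "adjoint_pair D D'"
    using hardy_adjoint_exists[OF D] .
  have "C \<tau> \<circ> D = C s \<circ> g \<circ> H"
    unfolding D_def o_assoc comp ..
  then have "posinormal (C s \<circ> g \<circ> H)"
    using posinormal_factor[OF adjoint_pair_bounded_clinear[OF C[OF \<tau>] adj] D adjoint_pair_sym[OF adj] D']
    by simp
  then show "coposinormal (composition_operator (parabolic_map w \<tau>))"
    using C[OF \<tau>] adjoint_pair_cadjoint[OF adj] by (simp add: coposinormal_def C_def)
qed

section \<open>Powers of the composition operator\<close>

text \<open>Stated through values because \<open>of_nat n * \<tau>\<close> may leave the range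
  \<open>Re < 1 / 2\<close> in which the composition lemmas apply.\<close>

lemma hardy_fun_composition_parabolic_funpow:
  assumes \<tau>: "Re \<tau> \<ge> 0" "Re \<tau> < 1 / 2" and "z \<in> ball 0 1"
  shows "hardy_fun ((composition_operator (parabolic_map w \<tau>) ^^ n) f) z =
    hardy_fun f (parabolic_map w (of_nat n * \<tau>) z)"
  using assms(3)
proof (induction n arbitrary: z)
  case (Suc n)
  have "parabolic_map w \<tau> z \<in> ball 0 1"
    using \<tau>(1) Suc.prems by (rule parabolic_map_in_ball)
  then have "hardy_fun ((composition_operator (parabolic_map w \<tau>) ^^ Suc n) f) z =
      hardy_fun f (parabolic_map w (of_nat n * \<tau>) (parabolic_map w \<tau> z))"
    using Suc by (simp add: hardy_fun_composition_parabolic[OF \<tau>])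
  also have "\<dots> = hardy_fun f (parabolic_map w (of_nat (Suc n) * \<tau>) z)"
    using \<tau> Suc.prems by (simp add: parabolic_map_comp algebra_simps)
  finally show ?case .
qed (simp add: parabolic_map_0)

text \<open>The unit circle is the line \<open>Re (1 / v) = 1 / 2\<close>; translation by
  \<open>T\<close> and inversion turn it into the circle of radius \<open>\<rho>\<close> around
  \<open>\<rho>\<close>. Denominators are cleared to fit
  \<open>norm_mult_fraction_le\<close>.\<close>

lemma parabolic_image_in_disk:
  assumes "Re T \<ge> 0" "cmod z = 1" and \<rho>: "\<rho> = 1 / (1 + 2 * Re T)"
  shows "cmod ((1 - of_real \<rho>) * (- T * cnj w * z + (1 + T)) - cnj w * ((1 - T) * z + w * T))
    = \<rho> * cmod (- T * cnj w * z + (1 + T))"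
proof -
  define v where "v = 1 - cnj w * z"
  define h where "h = 1 + T * v"
  have pos: "1 + 2 * Re T > 0" using assms by simp
  have "cmod (1 - v) = 1" using assms w by (simp add: v_def norm_mult)
  then have "(cmod (1 - v))\<^sup>2 = 1" by simp
  then have v: "2 * Re v = (cmod v)\<^sup>2"
    unfolding cmod_power2 by (simp add: power2_eq_square algebra_simps)
  have "(cmod (v - of_real \<rho> * h))\<^sup>2 = (cmod v)\<^sup>2 + (\<rho> * cmod h)\<^sup>2 - 2 * \<rho> * Re (v * cnj h)"
    unfolding power_mult_distrib cmod_power2 by (simp add: power2_eq_square algebra_simps)
  also have "Re (v * cnj h) = Re v + (cmod v)\<^sup>2 * Re T"
    unfolding cmod_power2 h_def by (simp add: power2_eq_square algebra_simps)
  also have "2 * \<rho> * (Re v + (cmod v)\<^sup>2 * Re T) = \<rho> * (2 * Re v + 2 * (cmod v)\<^sup>2 * Re T)"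
    by (simp add: algebra_simps)
  also have "\<dots> = \<rho> * ((1 + 2 * Re T) * (cmod v)\<^sup>2)"
    unfolding v by (simp add: algebra_simps)
  also have "\<dots> = (cmod v)\<^sup>2"
    using pos by (simp add: \<rho>)
  finally have "(cmod (v - of_real \<rho> * h))\<^sup>2 = (\<rho> * cmod h)\<^sup>2"
    by simp
  then have "cmod (v - of_real \<rho> * h) = \<rho> * cmod h"
    using pos by (simp add: power2_eq_iff_nonneg \<rho>)
  moreover have "(1 - of_real \<rho>) * (- T * cnj w * z + (1 + T)) - cnj w * ((1 - T) * z + w * T)
      = v - of_real \<rho> * h"
    unfolding parabolic_num parabolic_den h_def v_def by (simp add: algebra_simps)
  ultimately show ?thesis
    unfolding parabolic_den h_def v_def by simp
qed

text \<open>The image of the disk is the disk with centre \<open>c = (1 - \<rho>) * w\<close> and radius \<open>\<rho> < 1 / 2\<close>,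
  which stays away from 0. The powers of \<open>q x = 1 - x / c\<close> take the value 1 at 0, but the
  operator maps them to a null sequence.\<close>

lemma composition_parabolic_funpow_not_posinormal:
  assumes \<tau>: "Re \<tau> \<ge> 0" "Re \<tau> < 1 / 2" and n: "real n * Re \<tau> > 1 / 2"
  shows "\<not> posinormal (composition_operator (parabolic_map w \<tau>) ^^ n)"
proof
  define E where "E = composition_operator (parabolic_map w \<tau>) ^^ n"
  assume "posinormal (composition_operator (parabolic_map w \<tau>) ^^ n)"
  then have posi: "posinormal E" by (simp add: E_def)
  have E: "bounded_clinear E"
    unfolding E_def by (intro bounded_clinear_funpow bounded_clinear_composition_parabolic \<tau>)
  obtain E' where E': "adjoint_pair E E'"
    using hardy_adjoint_exists[OF E] .
  obtain K where K: "K \<ge> 0" "\<And>f. norm (E' f) \<le> K * norm (E f)"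
    using posinormal_norm_bound[OF posi E'] by metis
  define T where "T = of_nat n * \<tau>"
  have T: "Re T \<ge> 0" "Re T > 1 / 2" using \<tau> n by (simp_all add: T_def)
  have Ef: "hardy_fun (E f) z = hardy_fun f (parabolic_map w T z)" if "z \<in> ball 0 1" for f z
    unfolding E_def T_def using hardy_fun_composition_parabolic_funpow[OF \<tau> that] .
  define \<rho> where "\<rho> = 1 / (1 + 2 * Re T)"
  have \<rho>: "0 < \<rho>" "\<rho> < 1 / 2" using T by (simp_all add: \<rho>_def field_simps)
  define r where "r = complex_of_real (1 - \<rho>)"
  have r: "r \<noteq> 0" "cmod r = 1 - \<rho>" "r = 1 - of_real \<rho>"
    using \<rho> unfolding r_def by (simp_all only: norm_of_real) auto
  \<comment> \<open>Radius over modulus of the centre, which bounds \<open>|q|\<close> on the image;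
    it is below 1 because \<open>\<rho> < 1 / 2\<close>.\<close>
  define \<theta> where "\<theta> = \<rho> / (1 - \<rho>)"
  have \<theta>: "0 \<le> \<theta>" "\<theta> < 1" using \<rho> by (simp_all add: \<theta>_def field_simps)
  define one where "one = szego_kernel 0"
  have one: "hardy_fun one z = 1" if "z \<in> ball 0 1" for z
    using hardy_fun_kernel[of 0 z] that by (simp add: one_def)
  have E1: "E one = one"
    by (rule hardy_fun_eqI) (simp only: Ef one parabolic_map_in_ball[OF T(1)])
  \<comment> \<open>\<open>Q\<close> is multiplication by \<open>q\<close>, since
    \<open>1 / c = cnj w / r\<close>, and \<open>M\<close> is multiplication by \<open>q\<close>
    composed with the translation by \<open>T\<close>, written over one denominator.\<close>
  define Q where "Q = mult_linear (- cnj w / r) 1"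
  define M where "M = mult_fraction ((- r * T * cnj w - cnj w * (1 - T)) / r)
    ((r * (1 + T) - T) / r) (- T * cnj w) (1 + T)"
  note den = parabolic_den_coeff[OF T(1)]
  have num: "(- r * T * cnj w - cnj w * (1 - T)) / r * z + (r * (1 + T) - T) / r =
      (r * (- T * cnj w * z + (1 + T)) - cnj w * ((1 - T) * z + w * T)) / r" for z
    using r(1) by (simp add: field_simps w_cnj w_cnj')
  have M: "norm (M f) \<le> \<theta> * norm f" for f
    unfolding M_def
  proof (rule norm_mult_fraction_le[OF den \<theta>(1)])
    fix z :: complex assume z: "cmod z = 1"
    show "cmod ((- r * T * cnj w - cnj w * (1 - T)) / r * z + (r * (1 + T) - T) / r)
        \<le> \<theta> * cmod (- T * cnj w * z + (1 + T))"
      unfolding num norm_divide r(2) unfolding r(3) parabolic_image_in_disk[OF T(1) z \<rho>_def]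
      by (simp add: \<theta>_def)
  qed
  have Mf: "hardy_fun (M f) z = (- cnj w / r * parabolic_map w T z + 1) * hardy_fun f z"
    if z: "z \<in> ball 0 1" for f z
  proof -
    define h where "h = - T * cnj w * z + (1 + T)"
    define k where "k = (1 - T) * z + w * T"
    have "h \<noteq> 0"
      unfolding h_def parabolic_den using parabolic_den_neq_0[OF T(1) z] .
    then have "(r * h - cnj w * k) / r / h = - cnj w / r * (k / h) + 1"
      using r(1) by (simp add: field_simps)
    then show ?thesis
      unfolding M_def hardy_fun_mult_fraction[OF den z] num parabolic_map_def h_def k_def by simp
  qed
  have EQ: "E ((Q ^^ k) one) = (M ^^ k) one" for k
  proof (rule hardy_fun_eqI)
    fix z :: complex assume z: "z \<in> ball 0 1"
    note y = parabolic_map_in_ball[OF T(1) z]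
    have "hardy_fun (Q f) (parabolic_map w T z) =
        (- cnj w / r * parabolic_map w T z + 1) * hardy_fun f (parabolic_map w T z)" for f
      unfolding Q_def using y by (rule hardy_fun_mult_linear)
    from hardy_fun_mult_funpow[OF this] hardy_fun_mult_funpow[OF Mf[OF z]]
    show "hardy_fun (E ((Q ^^ k) one)) z = hardy_fun ((M ^^ k) one) z"
      by (simp only: Ef[OF z] one[OF y] one[OF z])
  qed
  have Mk: "norm ((M ^^ k) one) \<le> \<theta> ^ k * norm one" for k
  proof (induction k)
    case (Suc k)
    then have "\<theta> * norm ((M ^^ k) one) \<le> \<theta> * (\<theta> ^ k * norm one)"
      using \<theta>(1) by (rule mult_left_mono)
    then show ?case
      using M[of "(M ^^ k) one"] by (simp add: mult.assoc)
  qed simp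
  \<comment> \<open>\<open>E\<close> fixes the constant 1, so
    \<open><E' q^k, 1> = <q^k, E 1> = q(0)^k = 1\<close>, while posinormality bounds the left side
    by a multiple of \<open>\<theta>^k\<close>.\<close>
  have "1 \<le> K * norm one * norm one * \<theta> ^ k" for k
  proof -
    have "hardy_fun (Q f) 0 = 1 * hardy_fun f 0" for f
      by (simp add: Q_def hardy_fun_mult_linear)
    from hardy_fun_mult_funpow[OF this, of k one] have "cinner ((Q ^^ k) one) one = 1"
      using one[of 0] by (simp add: cinner_kernel one_def)
    then have "cinner (E' ((Q ^^ k) one)) one = 1"
      using adjoint_pairD[OF adjoint_pair_sym[OF E']] E1 by metis
    then have "1 \<le> norm (E' ((Q ^^ k) one)) * norm one"
      using cinner_Cauchy_Schwarz by (metis norm_one)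
    also have "\<dots> \<le> (K * (\<theta> ^ k * norm one)) * norm one"
      using K(2)[of "(Q ^^ k) one"] mult_left_mono[OF Mk[of k] K(1)]
      unfolding EQ by (intro mult_right_mono) auto
    finally show ?thesis by (simp add: mult_ac)
  qed
  moreover have "(\<lambda>k. K * norm one * norm one * \<theta> ^ k) \<longlonglongrightarrow> K * norm one * norm one * 0"
    using \<theta> by (intro tendsto_intros LIMSEQ_power_zero) auto
  ultimately have "1 \<le> K * norm one * norm one * 0"
    by (intro LIMSEQ_le_const) auto
  then show False by simp
qed

end

section \<open>Normal form of the symbol and conclusion\<close>

text \<open>Fixing \<open>w\<close> and having derivative 1 there determine the coefficients, up to
  the common factor \<open>e = c w + d\<close>, by the single parameter
  \<open>\<tau>\<close>.\<close>

lemma parabolic_type_representation: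
  assumes "linear_fractional_selfmap \<phi>" "parabolic_type \<phi>"
  obtains w \<tau> where "cmod w = 1" "Re \<tau> \<ge> 0" "\<phi> = parabolic_map w \<tau>"
proof -
  obtain a b c d where abcd: "a * d - b * c \<noteq> 0" "\<And>z. z \<in> ball 0 1 \<Longrightarrow> c * z + d \<noteq> 0"
      "\<And>z. \<phi> z = (a * z + b) / (c * z + d)" and self: "\<phi> ` ball 0 1 \<subseteq> ball 0 1"
    using assms(1) unfolding linear_fractional_selfmap_def by blast
  obtain w where "denjoy_wolff_point \<phi> w" and w: "cmod w = 1"
      and der: "(\<phi> has_field_derivative 1) (at w)"
    using assms(2) unfolding parabolic_type_def by auto
  then have fix': "\<phi> w = w"
    by (simp add: denjoy_wolff_point_def)
  note w_cnj = w_cnj[OF w]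
  define e where "e = c * w + d"
  \<comment> \<open>If \<open>e\<close> were 0, division by zero would give
    \<open>\<phi> w = 0\<close>, contradicting \<open>|w| = 1\<close>.\<close>
  have e: "e \<noteq> 0"
    using fix' w abcd(3)[of w] by (auto simp: e_def)
  have b: "a * w + b = w * e"
    using fix' e abcd(3)[of w] by (simp add: e_def field_simps)
  have "((\<lambda>z. (a * z + b) / (c * z + d)) has_field_derivative
      (a * (c * w + d) - (a * w + b) * c) / ((c * w + d) * (c * w + d))) (at w)"
    using e unfolding e_def by (auto intro!: derivative_eq_intros)
  then have "(a * e - (a * w + b) * c) / (e * e) = 1"
    using der abcd(3) unfolding e_def by (metis (no_types, lifting) DERIV_unique ext)
  then have "a * e - w * e * c = e * e"
    unfolding b using e by simp
  then have "e * a = e * (e + w * c)"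
    by (simp add: algebra_simps)
  then have a: "a = e + w * c"
    using e by simp
  \<comment> \<open>Read off from the coefficient of \<open>z\<close> in the denominator, which must
    be \<open>- e * \<tau> * cnj w\<close>.\<close>
  define \<tau> where "\<tau> = - c * w / e"
  have co: "a = e * (1 - \<tau>)" "c = e * (- \<tau> * cnj w)" "d = e * (1 + \<tau>)" "b = e * (w * \<tau>)"
  proof -
    have et: "e * \<tau> = - c * w" using e by (simp add: \<tau>_def)
    show "a = e * (1 - \<tau>)" unfolding right_diff_distrib et a by simp
    show "d = e * (1 + \<tau>)" unfolding distrib_left et by (simp add: e_def)
    have "e * (- \<tau> * cnj w) = - (e * \<tau>) * cnj w" by simp
    also have "\<dots> = c * (w * cnj w)" unfolding et by simp
    finally show "c = e * (- \<tau> * cnj w)" using w_cnj by simp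
    have "e * (w * \<tau>) = w * (e * \<tau>)" by simp
    also have "\<dots> = b" unfolding et using b by (simp add: a algebra_simps neg_eq_iff_add_eq_0)
    finally show "b = e * (w * \<tau>)" by simp
  qed
  have den: "c * z + d = e * (- \<tau> * cnj w * z + (1 + \<tau>))"
    and num: "a * z + b = e * ((1 - \<tau>) * z + w * \<tau>)" for z
    by (simp only: co(2,3), simp add: algebra_simps) (simp only: co(1,4), simp add: algebra_simps)
  have \<phi>: "\<phi> = parabolic_map w \<tau>"
    by (rule ext) (simp only: abcd(3) parabolic_map_def den num mult_divide_mult_cancel_left[OF e])
  have "Re \<tau> \<ge> 0"
  proof (rule parabolic_map_selfmap_Re[OF w])
    show "- \<tau> * cnj w * z + (1 + \<tau>) \<noteq> 0" if "z \<in> ball 0 1" for z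
      using abcd(2)[OF that] unfolding den by auto
  qed (use self \<phi> in simp)
  then show thesis
    using that w \<phi> by blast
qed

theorem mainTheorem2:
  fixes \<phi> :: "complex \<Rightarrow> complex"
  assumes "linear_fractional_selfmap \<phi>"
    and "parabolic_type \<phi>"
    and "\<not> disk_automorphism \<phi>"
    and "\<exists>z\<in>ball 0 1. \<phi> z = 0"
  shows "posinormal (composition_operator \<phi>) \<and> coposinormal (composition_operator \<phi>) \<and>
    (\<exists>N>0. \<forall>n\<ge>N. \<not> posinormal (composition_operator \<phi> ^^ n))"
proof -
  obtain w \<tau> where w: "cmod w = 1" and \<tau>: "Re \<tau> \<ge> 0" and \<phi>: "\<phi> = parabolic_map w \<tau>"
    using parabolic_type_representation assms(1,2) .
  have "Re \<tau> \<noteq> 0"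
    using parabolic_map_automorphism[OF w] assms(3) \<phi> by blast
  with \<tau> have pos: "Re \<tau> > 0" by simp
  have half: "Re \<tau> < 1 / 2"
    using parabolic_map_zero[OF w \<tau>] assms(4) \<phi> by blast
  \<comment> \<open>From this exponent on the closure of the image of the disk misses 0.\<close>
  obtain N where N: "1 / 2 < real N * Re \<tau>"
    using reals_Archimedean3[OF pos] by blast
  have "\<not> posinormal (composition_operator \<phi> ^^ n)" if "n \<ge> N" for n
    unfolding \<phi>
  proof (rule composition_parabolic_funpow_not_posinormal[OF w \<tau> half])
    have "real N * Re \<tau> \<le> real n * Re \<tau>"
      using that \<tau> by (intro mult_right_mono) auto
    then show "1 / 2 < real n * Re \<tau>" using N by linarith
  qed
  moreover have "N > 0"
    using N by (cases N) auto
  ultimately show ?thesis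
    using composition_parabolic_posinormal[OF w \<tau> half] \<phi> by blast
qed

end
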